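(* Let $\langle i_X:\mathcal M X\to\mathcal P X\leftarrow\mathcal M'X:i'_X;\ X\in\mathcal C\rangle$ be a temporal doctrine and $x:1\to X$ a point in $\mathcal C$. There are isomorphisms in $\mathcal B1$ $$j_1^{-1}(x\cdot M)\cong\underline{\rm nat}_X(X/x,M),\qquad j_1^{-1}(x\cdot M)\cong\underline{\rm ten}_X(x\backslash X,M)$$ natural in $M\in\mathcal M X$; and dually, isomorphisms $${j'_1}^{-1}(x'\cdot N)\cong\underline{\rm nat}'_X(x\backslash X,N),\qquad {j'_1}^{-1}(x'\cdot N)\cong\underline{\rm ten}_X(N,X/x)$$ natural in $N\in\mathcal M'X$.
   Context: A temporal doctrine $\langle i_X:\mathcal M X\to\mathcal P X\leftarrow\mathcal M'X:i'_X;\ X\in\mathcal C\rangle$ consists of a category $\mathcal C$, three $\mathcal C$-indexed categories $\mathcal M,\mathcal P,\mathcal M'$ (pseudofunctors $\mathcal C^{op}\to\mathbf{Cat}$), and two indexed functors $i:\mathcal M\to\mathcal P$, $i':\mathcal M'\to\mathcal P$. The substitution functors along $f:X\to Y$ are written $f\cdot(-):\mathcal M Y\to\mathcal M X$, $f'\cdot(-):\mathcal M'Y\to\mathcal M'X$, $f^*:\mathcal P Y\to\mathcal P X$; thus $i_X(f\cdot M)\cong f^*i_Y M$ and $i'_X(f'\cdot N)\cong f^*i'_Y N$, coherently. $\mathcal B X:=\mathcal M X\times_{\mathcal P X}\mathcal M'X$ denotes the indexed pullback of $i$ and $i'$ (equalities up to the coherent isomorphisms), with projections $j_X:\mathcal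 B X\to\mathcal M X$, $j'_X:\mathcal B X\to\mathcal M'X$, and $b_X:=i_Xj_X=i'_Xj'_X:\mathcal B X\to\mathcal P X$. The axioms are: (A1) $\mathcal C$ has a terminal object $1$. (A2) Each $\mathcal P X$ is cartesian closed, with terminal object $1_X$, products $P\times_X Q$ and exponentials $P\Rightarrow Q$. (A3) Each $f^*$ has left and right adjoints $\Sigma_f\dashv f^*\dashv\Pi_f$. (A4) $i_X$ and $i'_X$ have left and right adjoints: $\Diamond_X\dashv i_X\dashv\Box_X$, $\Diamond'_X\dashv i'_X\dashv\Box'_X$. (A5) (comprehension) The canonical functor $c_X:\mathcal C/X\to\mathcal P X$, sending $f:T\to X$ to $\Sigma_f1_T$, has a right adjoint $k_X:\mathcal P X\to\mathcal C/X$. (B1) $i_X$ and $i'_X$ are fully faithful. (B2) (Frobenius law) $\Sigma_fP\times_YQ\cong\Sigma_f(P\times_Xf^*Q)$ canonically, naturally in $P\in\mathcal P X$, $Q\in\mathcal P Y$, for every $f:X\to Y$. (B3) (mixed Frobenius laws) The units of $\Diamond_X\dashv i_X$ and $\Diamond'_X\dashv i'_X$ induce isomorphisms $\Diamond_X(P\times_Xi'_XN)\cong\Diamond_X(i_X\Diamond_XP\times_Xi'_XN)$ and $\Diamond'_X(P\times_Xi_XM)\cong\Diamond'_X(i'_X\Diamond'_XP\times_Xi_XM)$, natural in $P\in\mathcal P X$, $M\in\mathcal M X$, $N\in\mathcal M'X$. (B4) $j_1:\mathcal B1\to\mathcal M1$ and $j'_1:\mathcal B1\to\mathcal M'1$ are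 isomorphisms. (B5) Each $k_X$ is fully faithful. Derived notation. $\top_X$ and $\top'_X$ are the terminal objects of $\mathcal M X$ and $\mathcal M'X$. For $f:X\to Y$, $f\cdot(-)$ has left adjoint $\exists_f:=\Diamond_Y\Sigma_fi_X$ and right adjoint $\forall_f:=\Box_Y\Pi_fi_X$, and $f'\cdot(-)$ has left adjoint $\exists'_f:=\Diamond'_Y\Sigma_fi'_X$ and right adjoint $\forall'_f:=\Box'_Y\Pi_fi'_X$. The functor $X^*b_1:\mathcal B1\to\mathcal P X$ ($X$ denoting here the map $X\to1$) has a left adjoint $\underline{\rm coend}_X$ and a right adjoint $\underline{\rm end}_X$. For $L,M\in\mathcal M X$, $N,O\in\mathcal M'X$: $\underline{\rm ten}_X(N,M):=\underline{\rm coend}_X(i'_XN\times_Xi_XM)$, $\underline{\rm nat}_X(L,M):=\underline{\rm end}_X(i_XL\Rightarrow i_XM)$, $\underline{\rm nat}'_X(N,O):=\underline{\rm end}_X(i'_XN\Rightarrow i'_XO)$, objects of $\mathcal B1$. For a point $x:1\to X$, the left and right slices are $X/x:=\exists_x\top_1\in\mathcal M X$ and $x\backslash X:=\exists'_x\top'_1\in\mathcal M'X$. For a point $x$, $x\cdot M\in\mathcal M1$ and $x'\cdot N\in\mathcal M'1$ are the substitutions along $x$. *)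

theory Defs
  imports Main
begin

section \<open>Categories, functors, natural isomorphisms\<close>

record ('o, 'a) cat =
  Ob :: "'o set"
  Ar :: "'a set"
  Dom :: "'a \<Rightarrow> 'o"
  Cod :: "'a \<Rightarrow> 'o"
  Idt :: "'o \<Rightarrow> 'a"
  Cmp :: "'a \<Rightarrow> 'a \<Rightarrow> 'a" (infixl "\<cdot>\<index>" 70)

definition hom :: "('o, 'a) cat \<Rightarrow> 'o \<Rightarrow> 'o \<Rightarrow> 'a set" where
  "hom C A B = {f \<in> Ar C. Dom C f = A \<and> Cod C f = B}"

locale category =
  fixes C :: "('o, 'a) cat" (structure)
  assumes Dom_Ob: "f \<in> Ar C \<Longrightarrow> Dom C f \<in> Ob C"
    and Cod_Ob: "f \<in> Ar C \<Longrightarrow> Cod C f \<in> Ob C"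
    and Idt_hom: "A \<in> Ob C \<Longrightarrow> Idt C A \<in> hom C A A"
    and Cmp_hom: "\<lbrakk>f \<in> hom C A B; g \<in> hom C B E\<rbrakk> \<Longrightarrow> g \<cdot> f \<in> hom C A E"
    and Idt_right: "f \<in> hom C A B \<Longrightarrow> f \<cdot> Idt C A = f"
    and Idt_left: "f \<in> hom C A B \<Longrightarrow> Idt C B \<cdot> f = f"
    and Cmp_assoc: "\<lbrakk>f \<in> hom C A B; g \<in> hom C B E; h \<in> hom C E H\<rbrakk>
      \<Longrightarrow> h \<cdot> (g \<cdot> f) = (h \<cdot> g) \<cdot> f"

definition iso :: "('o, 'a) cat \<Rightarrow> 'o \<Rightarrow> 'o \<Rightarrow> 'a set" where
  "iso C A B = {f \<in> hom C A B. \<exists>g \<in> hom C B A.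
     g \<cdot>\<^bsub>C\<^esub> f = Idt C A \<and> f \<cdot>\<^bsub>C\<^esub> g = Idt C B}"

definition terminal :: "('o, 'a) cat \<Rightarrow> 'o \<Rightarrow> bool" where
  "terminal C t \<longleftrightarrow> t \<in> Ob C \<and> (\<forall>A \<in> Ob C. \<exists>!f. f \<in> hom C A t)"

definition to_terminal :: "('o, 'a) cat \<Rightarrow> 'o \<Rightarrow> 'o \<Rightarrow> 'a" where
  "to_terminal C t A = (THE f. f \<in> hom C A t)"

record ('o1, 'a1, 'o2, 'a2) func =
  ob :: "'o1 \<Rightarrow> 'o2"
  ar :: "'a1 \<Rightarrow> 'a2"

definition id_func :: "('o, 'a, 'o, 'a) func" where
  "id_func = \<lparr>ob = (\<lambda>A. A), ar = (\<lambda>f. f)\<rparr>"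

definition comp_func ::
  "('o2, 'a2, 'o3, 'a3) func \<Rightarrow> ('o1, 'a1, 'o2, 'a2) func \<Rightarrow> ('o1, 'a1, 'o3, 'a3) func"
  (infixr "\<odot>" 75) where
  "G \<odot> F = \<lparr>ob = (\<lambda>A. ob G (ob F A)), ar = (\<lambda>f. ar G (ar F f))\<rparr>"

locale is_functor = A: category A + B: category B
  for A :: "('o1, 'a1) cat" and B :: "('o2, 'a2) cat" +
  fixes F :: "('o1, 'a1, 'o2, 'a2) func"
  assumes ob_Ob: "X \<in> Ob A \<Longrightarrow> ob F X \<in> Ob B"
    and ar_hom: "f \<in> hom A X Y \<Longrightarrow> ar F f \<in> hom B (ob F X) (ob F Y)"
    and ar_Idt: "X \<in> Ob A \<Longrightarrow> ar F (Idt A X) = Idt B (ob F X)"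
    and ar_Cmp: "\<lbrakk>f \<in> hom A X Y; g \<in> hom A Y Z\<rbrakk>
      \<Longrightarrow> ar F (g \<cdot>\<^bsub>A\<^esub> f) = ar F g \<cdot>\<^bsub>B\<^esub> ar F f"

definition fully_faithful ::
  "('o1, 'a1) cat \<Rightarrow> ('o2, 'a2) cat \<Rightarrow> ('o1, 'a1, 'o2, 'a2) func \<Rightarrow> bool" where
  "fully_faithful A B F \<longleftrightarrow> (\<forall>X \<in> Ob A. \<forall>Y \<in> Ob A.
     bij_betw (ar F) (hom A X Y) (hom B (ob F X) (ob F Y)))"

locale nat_trans = F: is_functor A B F + G: is_functor A B G
  for A :: "('o1, 'a1) cat" and B :: "('o2, 'a2) cat" and F G +
  fixes \<tau> :: "'o1 \<Rightarrow> 'a2"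
  assumes component: "X \<in> Ob A \<Longrightarrow> \<tau> X \<in> hom B (ob F X) (ob G X)"
    and naturality: "f \<in> hom A X Y \<Longrightarrow> \<tau> Y \<cdot>\<^bsub>B\<^esub> ar F f = ar G f \<cdot>\<^bsub>B\<^esub> \<tau> X"

locale nat_iso = nat_trans +
  assumes component_iso: "X \<in> Ob A \<Longrightarrow> \<tau> X \<in> iso B (ob F X) (ob G X)"

definition naturally_isomorphic ::
  "('o1, 'a1) cat \<Rightarrow> ('o2, 'a2) cat
   \<Rightarrow> ('o1, 'a1, 'o2, 'a2) func \<Rightarrow> ('o1, 'a1, 'o2, 'a2) func \<Rightarrow> bool" where
  "naturally_isomorphic A B F G \<longleftrightarrow> (\<exists>\<tau>. nat_iso A B F G \<tau>)"

definition quasi_inverse ::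
  "('o1, 'a1) cat \<Rightarrow> ('o2, 'a2) cat
   \<Rightarrow> ('o1, 'a1, 'o2, 'a2) func \<Rightarrow> ('o2, 'a2, 'o1, 'a1) func \<Rightarrow> bool" where
  "quasi_inverse A B F G \<longleftrightarrow> is_functor A B F \<and> is_functor B A G \<and>
     naturally_isomorphic A A (G \<odot> F) id_func \<and>
     naturally_isomorphic B B (F \<odot> G) id_func"

text \<open>\<open>adjunction A B F G \<eta> \<epsilon>\<close>: \<open>F : A \<rightarrow> B\<close> is left adjoint to \<open>G : B \<rightarrow> A\<close>.\<close>

locale adjunction =
  unit: nat_trans A A id_func "G \<odot> F" \<eta> + counit: nat_trans B B "F \<odot> G" id_func \<epsilon>
  for A :: "('o1, 'a1) cat" and B :: "('o2, 'a2) cat" and F G \<eta> \<epsilon> +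
  assumes left_functor: "is_functor A B F"
    and right_functor: "is_functor B A G"
    and triangle_left: "X \<in> Ob A \<Longrightarrow> \<epsilon> (ob F X) \<cdot>\<^bsub>B\<^esub> ar F (\<eta> X) = Idt B (ob F X)"
    and triangle_right: "Y \<in> Ob B \<Longrightarrow> ar G (\<epsilon> Y) \<cdot>\<^bsub>A\<^esub> \<eta> (ob G Y) = Idt A (ob G Y)"

definition adjoint ::
  "('o1, 'a1) cat \<Rightarrow> ('o2, 'a2) cat
   \<Rightarrow> ('o1, 'a1, 'o2, 'a2) func \<Rightarrow> ('o2, 'a2, 'o1, 'a1) func \<Rightarrow> bool" where
  "adjoint A B F G \<longleftrightarrow> (\<exists>\<eta> \<epsilon>. adjunction A B F G \<eta> \<epsilon>)"

section \<open>Cartesian closed categories\<close>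

record ('o, 'a) ccc =
  One :: "'o"
  Prod :: "'o \<Rightarrow> 'o \<Rightarrow> 'o"
  Proj1 :: "'o \<Rightarrow> 'o \<Rightarrow> 'a"
  Proj2 :: "'o \<Rightarrow> 'o \<Rightarrow> 'a"
  Exp :: "'o \<Rightarrow> 'o \<Rightarrow> 'o"  \<comment> \<open>\<open>Exp S A B\<close> is \<open>A \<Rightarrow> B\<close>\<close>
  Ev :: "'o \<Rightarrow> 'o \<Rightarrow> 'a"  \<comment> \<open>\<open>(A \<Rightarrow> B) \<times> A \<rightarrow> B\<close>\<close>

definition pairing :: "('o, 'a) cat \<Rightarrow> ('o, 'a) ccc \<Rightarrow> 'a \<Rightarrow> 'a \<Rightarrow> 'a" where
  "pairing K S f g = (THE h. h \<in> hom K (Dom K f) (Prod S (Cod K f) (Cod K g)) \<and>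
     Proj1 S (Cod K f) (Cod K g) \<cdot>\<^bsub>K\<^esub> h = f \<and>
     Proj2 S (Cod K f) (Cod K g) \<cdot>\<^bsub>K\<^esub> h = g)"

definition prod_map :: "('o, 'a) cat \<Rightarrow> ('o, 'a) ccc \<Rightarrow> 'a \<Rightarrow> 'a \<Rightarrow> 'a" where
  "prod_map K S f g = pairing K S
     (f \<cdot>\<^bsub>K\<^esub> Proj1 S (Dom K f) (Dom K g)) (g \<cdot>\<^bsub>K\<^esub> Proj2 S (Dom K f) (Dom K g))"

locale cartesian_closed = category K for K :: "('o, 'a) cat" +
  fixes S :: "('o, 'a) ccc"
  assumes One_terminal: "terminal K (One S)"
    and Prod_Ob: "\<lbrakk>A \<in> Ob K; B \<in> Ob K\<rbrakk> \<Longrightarrow> Prod S A B \<in> Ob K"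
    and Proj1_hom: "\<lbrakk>A \<in> Ob K; B \<in> Ob K\<rbrakk> \<Longrightarrow> Proj1 S A B \<in> hom K (Prod S A B) A"
    and Proj2_hom: "\<lbrakk>A \<in> Ob K; B \<in> Ob K\<rbrakk> \<Longrightarrow> Proj2 S A B \<in> hom K (Prod S A B) B"
    and Prod_universal: "\<lbrakk>f \<in> hom K T A; g \<in> hom K T B\<rbrakk> \<Longrightarrow>
      \<exists>!h. h \<in> hom K T (Prod S A B) \<and>
        Proj1 S A B \<cdot>\<^bsub>K\<^esub> h = f \<and> Proj2 S A B \<cdot>\<^bsub>K\<^esub> h = g"
    and Exp_Ob: "\<lbrakk>A \<in> Ob K; B \<in> Ob K\<rbrakk> \<Longrightarrow> Exp S A B \<in> Ob K"
    and Ev_hom: "\<lbrakk>A \<in> Ob K; B \<in> Ob K\<rbrakk> \<Longrightarrow> Ev S A B \<in> hom K (Prod S (Exp S A B) A) B"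
    and Exp_universal: "\<lbrakk>A \<in> Ob K; B \<in> Ob K; T \<in> Ob K; f \<in> hom K (Prod S T A) B\<rbrakk> \<Longrightarrow>
      \<exists>!h. h \<in> hom K T (Exp S A B) \<and> Ev S A B \<cdot>\<^bsub>K\<^esub> prod_map K S h (Idt K A) = f"

text \<open>The functors \<open>A \<times> -\<close>, \<open>- \<times> B\<close> and \<open>A \<Rightarrow> -\<close>.\<close>

definition prod_left :: "('o, 'a) cat \<Rightarrow> ('o, 'a) ccc \<Rightarrow> 'o \<Rightarrow> ('o, 'a, 'o, 'a) func" where
  "prod_left K S A = \<lparr>ob = (\<lambda>B. Prod S A B), ar = (\<lambda>g. prod_map K S (Idt K A) g)\<rparr>"

definition prod_right :: "('o, 'a) cat \<Rightarrow> ('o, 'a) ccc \<Rightarrow> 'o \<Rightarrow> ('o, 'a, 'o, 'a) func" where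
  "prod_right K S B = \<lparr>ob = (\<lambda>A. Prod S A B), ar = (\<lambda>f. prod_map K S f (Idt K B))\<rparr>"

definition exp_func :: "('o, 'a) cat \<Rightarrow> ('o, 'a) ccc \<Rightarrow> 'o \<Rightarrow> ('o, 'a, 'o, 'a) func" where
  "exp_func K S A = \<lparr>ob = (\<lambda>B. Exp S A B),
     ar = (\<lambda>g. THE h. h \<in> hom K (Exp S A (Dom K g)) (Exp S A (Cod K g)) \<and>
       Ev S A (Cod K g) \<cdot>\<^bsub>K\<^esub> prod_map K S h (Idt K A) = g \<cdot>\<^bsub>K\<^esub> Ev S A (Dom K g))\<rparr>"

section \<open>Slice categories and pullbacks of categories\<close>

text \<open>An arrow \<open>f \<rightarrow> g\<close> of the slice \<open>C/X\<close> is a triple \<open>(f, h, g)\<close> with \<open>g \<cdot> h = f\<close>.\<close>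

definition over_cat :: "('o, 'a) cat \<Rightarrow> 'o \<Rightarrow> ('a, 'a \<times> 'a \<times> 'a) cat" where
  "over_cat C X = \<lparr>
     Ob = {f \<in> Ar C. Cod C f = X},
     Ar = {(f, h, g). f \<in> Ar C \<and> Cod C f = X \<and> g \<in> Ar C \<and> Cod C g = X \<and>
            h \<in> hom C (Dom C f) (Dom C g) \<and> g \<cdot>\<^bsub>C\<^esub> h = f},
     Dom = (\<lambda>(f, h, g). f),
     Cod = (\<lambda>(f, h, g). g),
     Idt = (\<lambda>f. (f, Idt C (Dom C f), f)),
     Cmp = (\<lambda>(f', k, g) (f, h, g'). (f, k \<cdot>\<^bsub>C\<^esub> h, g))\<rparr>"

text \<open>
  The pullback of \<open>F : A \<rightarrow> K\<close> and \<open>F' : A' \<rightarrow> K\<close> in the sense appropriate to indexed categories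
  with pseudofunctorial substitution: since substitution preserves an equality \<open>F M = F' N\<close>
  only up to coherent isomorphism, an object consists of \<open>M\<close>, \<open>N\<close> and an isomorphism
  \<open>\<phi> : F M \<rightarrow> F' N\<close>.  An arrow is a pair of arrows compatible with these isomorphisms,
  stored together with its source and target.
\<close>

type_synonym ('o1, 'o2, 'k) pb_ob = "'o1 \<times> 'o2 \<times> 'k"
type_synonym ('o1, 'a1, 'o2, 'a2, 'k) pb_ar =
  "('o1, 'o2, 'k) pb_ob \<times> 'a1 \<times> 'a2 \<times> ('o1, 'o2, 'k) pb_ob"

definition pullback_cat ::
  "('o1, 'a1) cat \<Rightarrow> ('o2, 'a2) cat \<Rightarrow> ('o, 'k) cat
   \<Rightarrow> ('o1, 'a1, 'o, 'k) func \<Rightarrow> ('o2, 'a2, 'o, 'k) func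
   \<Rightarrow> (('o1, 'o2, 'k) pb_ob, ('o1, 'a1, 'o2, 'a2, 'k) pb_ar) cat" where
  "pullback_cat A A' K F F' = (let
     Obs = {(M, N, \<phi>). M \<in> Ob A \<and> N \<in> Ob A' \<and> \<phi> \<in> iso K (ob F M) (ob F' N)}
   in \<lparr>
     Ob = Obs,
     Ar = {((M, N, \<phi>), g, h, (M', N', \<phi>')).
            (M, N, \<phi>) \<in> Obs \<and> (M', N', \<phi>') \<in> Obs \<and> g \<in> hom A M M' \<and> h \<in> hom A' N N' \<and>
            ar F' h \<cdot>\<^bsub>K\<^esub> \<phi> = \<phi>' \<cdot>\<^bsub>K\<^esub> ar F g},
     Dom = (\<lambda>(s, g, h, t). s),
     Cod = (\<lambda>(s, g, h, t). t),
     Idt = (\<lambda>(M, N, \<phi>). ((M, N, \<phi>), Idt A M, Idt A' N, (M, N, \<phi>))),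
     Cmp = (\<lambda>(s', g', h', t') (s, g, h, t). (s, g' \<cdot>\<^bsub>A\<^esub> g, h' \<cdot>\<^bsub>A'\<^esub> h, t'))\<rparr>)"

definition pb_fst :: "(('o1, 'o2, 'k) pb_ob, ('o1, 'a1, 'o2, 'a2, 'k) pb_ar, 'o1, 'a1) func" where
  "pb_fst = \<lparr>ob = (\<lambda>(M, N, \<phi>). M), ar = (\<lambda>(s, g, h, t). g)\<rparr>"

definition pb_snd :: "(('o1, 'o2, 'k) pb_ob, ('o1, 'a1, 'o2, 'a2, 'k) pb_ar, 'o2, 'a2) func" where
  "pb_snd = \<lparr>ob = (\<lambda>(M, N, \<phi>). N), ar = (\<lambda>(s, g, h, t). h)\<rparr>"

section \<open>Indexed categories and indexed functors\<close>

text \<open>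
  A pseudofunctor from the opposite of \<open>C\<close> to categories: \<open>Sub E f\<close> is substitution
  \<open>f\<^sup>* : Fib E Y \<rightarrow> Fib E X\<close> along \<open>f : X \<rightarrow> Y\<close>, with coherent isomorphisms
  \<open>unitor E X P : P \<rightarrow> (id X)\<^sup>* P\<close> and \<open>compositor E f g P : f\<^sup>* (g\<^sup>* P) \<rightarrow> (g \<cdot> f)\<^sup>* P\<close>.
\<close>

record ('c, 'f, 'o, 'a) icat =
  Fib :: "'c \<Rightarrow> ('o, 'a) cat"
  Sub :: "'f \<Rightarrow> ('o, 'a, 'o, 'a) func"
  unitor :: "'c \<Rightarrow> 'o \<Rightarrow> 'a"
  compositor :: "'f \<Rightarrow> 'f \<Rightarrow> 'o \<Rightarrow> 'a"

locale indexed_category = category C for C :: "('c, 'f) cat" +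
  fixes E :: "('c, 'f, 'o, 'a) icat"
  assumes Fib_category: "X \<in> Ob C \<Longrightarrow> category (Fib E X)"
    and Sub_functor: "f \<in> hom C X Y \<Longrightarrow> is_functor (Fib E Y) (Fib E X) (Sub E f)"
    and unitor_iso: "X \<in> Ob C \<Longrightarrow>
      nat_iso (Fib E X) (Fib E X) id_func (Sub E (Idt C X)) (unitor E X)"
    and compositor_iso: "\<lbrakk>f \<in> hom C X Y; g \<in> hom C Y Z\<rbrakk> \<Longrightarrow>
      nat_iso (Fib E Z) (Fib E X) (Sub E f \<odot> Sub E g) (Sub E (g \<cdot>\<^bsub>C\<^esub> f)) (compositor E f g)"
    and coherence_unit_left: "\<lbrakk>f \<in> hom C X Y; P \<in> Ob (Fib E Y)\<rbrakk> \<Longrightarrow>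
      compositor E (Idt C X) f P \<cdot>\<^bsub>Fib E X\<^esub> unitor E X (ob (Sub E f) P)
        = Idt (Fib E X) (ob (Sub E f) P)"
    and coherence_unit_right: "\<lbrakk>f \<in> hom C X Y; P \<in> Ob (Fib E Y)\<rbrakk> \<Longrightarrow>
      compositor E f (Idt C Y) P \<cdot>\<^bsub>Fib E X\<^esub> ar (Sub E f) (unitor E Y P)
        = Idt (Fib E X) (ob (Sub E f) P)"
    and coherence_assoc:
      "\<lbrakk>f \<in> hom C W X; g \<in> hom C X Y; h \<in> hom C Y Z; P \<in> Ob (Fib E Z)\<rbrakk> \<Longrightarrow>
      compositor E (g \<cdot>\<^bsub>C\<^esub> f) h P \<cdot>\<^bsub>Fib E W\<^esub> compositor E f g (ob (Sub E h) P)
        = compositor E f (h \<cdot>\<^bsub>C\<^esub> g) P \<cdot>\<^bsub>Fib E W\<^esub> ar (Sub E f) (compositor E g h P)"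

text \<open>
  An indexed functor \<open>I : E \<rightarrow> E'\<close> (a pseudonatural transformation) has components
  \<open>at I X : Fib E X \<rightarrow> Fib E' X\<close> and coherent isomorphisms
  \<open>square I f M : at I X (f\<^sup>* M) \<rightarrow> f\<^sup>* (at I Y M)\<close> for \<open>f : X \<rightarrow> Y\<close>.
\<close>

record ('c, 'f, 'o1, 'a1, 'o2, 'a2) ifunc =
  at :: "'c \<Rightarrow> ('o1, 'a1, 'o2, 'a2) func"
  square :: "'f \<Rightarrow> 'o1 \<Rightarrow> 'a2"

locale indexed_functor = E: indexed_category C E + E': indexed_category C E'
  for C :: "('c, 'f) cat" and E :: "('c, 'f, 'o1, 'a1) icat" and E' :: "('c, 'f, 'o2, 'a2) icat" +
  fixes I :: "('c, 'f, 'o1, 'a1, 'o2, 'a2) ifunc"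
  assumes at_functor: "X \<in> Ob C \<Longrightarrow> is_functor (Fib E X) (Fib E' X) (at I X)"
    and square_iso: "f \<in> hom C X Y \<Longrightarrow>
      nat_iso (Fib E Y) (Fib E' X) (at I X \<odot> Sub E f) (Sub E' f \<odot> at I Y) (square I f)"
    and coherence_unit: "\<lbrakk>X \<in> Ob C; M \<in> Ob (Fib E X)\<rbrakk> \<Longrightarrow>
      square I (Idt C X) M \<cdot>\<^bsub>Fib E' X\<^esub> ar (at I X) (unitor E X M)
        = unitor E' X (ob (at I X) M)"
    and coherence_comp: "\<lbrakk>f \<in> hom C X Y; g \<in> hom C Y Z; M \<in> Ob (Fib E Z)\<rbrakk> \<Longrightarrow>
      square I (g \<cdot>\<^bsub>C\<^esub> f) M \<cdot>\<^bsub>Fib E' X\<^esub> ar (at I X) (compositor E f g M)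
        = compositor E' f g (ob (at I Z) M) \<cdot>\<^bsub>Fib E' X\<^esub>
          (ar (Sub E' f) (square I g M) \<cdot>\<^bsub>Fib E' X\<^esub> square I f (ob (Sub E g) M))"

section \<open>Temporal doctrines\<close>

text \<open>
  The data of a temporal doctrine.  The three indexed categories are \<open>Mc\<close>, \<open>Pc\<close> and \<open>Mc'\<close>;
  \<open>Base\<close> has terminal object \<open>pt\<close>.  The adjoints occurring in the canonical maps and in
  the derived notation (\<open>\<Sigma>\<close>, \<open>\<diamond>\<close>, \<open>\<diamond>'\<close>) are given with unit and counit; the other
  ones (\<open>\<Pi>\<close>, \<open>\<box>\<close>, \<open>\<box>'\<close>, \<open>k\<close>) are only required to exist.
\<close>

record ('c, 'f, 'm, 'ma, 'p, 'pa, 'n, 'na) tdoctrine =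
  Base :: "('c, 'f) cat"
  pt :: 'c
  Mc :: "('c, 'f, 'm, 'ma) icat"
  Pc :: "('c, 'f, 'p, 'pa) icat"
  Mc' :: "('c, 'f, 'n, 'na) icat"
  im :: "('c, 'f, 'm, 'ma, 'p, 'pa) ifunc"
  im' :: "('c, 'f, 'n, 'na, 'p, 'pa) ifunc"
  CC :: "'c \<Rightarrow> ('p, 'pa) ccc"
  Sig :: "'f \<Rightarrow> ('p, 'pa, 'p, 'pa) func"
  Sig_unit :: "'f \<Rightarrow> 'p \<Rightarrow> 'pa"
  Sig_counit :: "'f \<Rightarrow> 'p \<Rightarrow> 'pa"
  Dia :: "'c \<Rightarrow> ('p, 'pa, 'm, 'ma) func"
  Dia_unit :: "'c \<Rightarrow> 'p \<Rightarrow> 'pa"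
  Dia_counit :: "'c \<Rightarrow> 'm \<Rightarrow> 'ma"
  Dia' :: "'c \<Rightarrow> ('p, 'pa, 'n, 'na) func"
  Dia_unit' :: "'c \<Rightarrow> 'p \<Rightarrow> 'pa"
  Dia_counit' :: "'c \<Rightarrow> 'n \<Rightarrow> 'na"

definition BB ::
  "('c, 'f, 'm, 'ma, 'p, 'pa, 'n, 'na) tdoctrine \<Rightarrow> 'c
   \<Rightarrow> (('m, 'n, 'pa) pb_ob, ('m, 'ma, 'n, 'na, 'pa) pb_ar) cat" where
  "BB D X = pullback_cat (Fib (Mc D) X) (Fib (Mc' D) X) (Fib (Pc D) X) (at (im D) X) (at (im' D) X)"

definition bb ::
  "('c, 'f, 'm, 'ma, 'p, 'pa, 'n, 'na) tdoctrine \<Rightarrow> 'c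
   \<Rightarrow> (('m, 'n, 'pa) pb_ob, ('m, 'ma, 'n, 'na, 'pa) pb_ar, 'p, 'pa) func" where
  "bb D X = at (im D) X \<odot> pb_fst"

text \<open>
  The canonical functor \<open>c\<^sub>X : C/X \<rightarrow> P X\<close>.  An arrow \<open>h\<close> from \<open>f : T \<rightarrow> X\<close> to \<open>g : U \<rightarrow> X\<close>
  goes to the transpose along \<open>\<Sigma>\<^sub>f \<stileturn> f\<^sup>*\<close> of
  \<open>1\<^sub>T \<rightarrow> h\<^sup>* 1\<^sub>U \<rightarrow> h\<^sup>* g\<^sup>* \<Sigma>\<^sub>g 1\<^sub>U \<rightarrow> f\<^sup>* \<Sigma>\<^sub>g 1\<^sub>U\<close>;
  the first arrow exists uniquely since \<open>h\<^sup>*\<close>, being a right adjoint, preserves terminal objects.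
\<close>

definition canon ::
  "('c, 'f, 'm, 'ma, 'p, 'pa, 'n, 'na) tdoctrine \<Rightarrow> 'c \<Rightarrow> ('f, 'f \<times> 'f \<times> 'f, 'p, 'pa) func" where
  "canon D X = \<lparr>
     ob = (\<lambda>f. ob (Sig D f) (One (CC D (Dom (Base D) f)))),
     ar = (\<lambda>(f, h, g). let
        T = Dom (Base D) f; PT = Fib (Pc D) T;
        oneU = One (CC D (Dom (Base D) g));
        s = ob (Sig D g) oneU;
        u = to_terminal PT (ob (Sub (Pc D) h) oneU) (One (CC D T));
        m = compositor (Pc D) h g s \<cdot>\<^bsub>PT\<^esub> (ar (Sub (Pc D) h) (Sig_unit D g oneU) \<cdot>\<^bsub>PT\<^esub> u)
      in Sig_counit D f s \<cdot>\<^bsub>Fib (Pc D) X\<^esub> ar (Sig D f) m)\<rparr>"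

text \<open>The canonical map \<open>\<Sigma>\<^sub>f (P \<times> f\<^sup>* Q) \<rightarrow> \<Sigma>\<^sub>f P \<times> Q\<close>, for \<open>f : X \<rightarrow> Y\<close>.\<close>

definition frobenius_map ::
  "('c, 'f, 'm, 'ma, 'p, 'pa, 'n, 'na) tdoctrine \<Rightarrow> 'f \<Rightarrow> 'p \<Rightarrow> 'p \<Rightarrow> 'pa" where
  "frobenius_map D f P Q = (let
      X = Dom (Base D) f; Y = Cod (Base D) f; Q' = ob (Sub (Pc D) f) Q
    in pairing (Fib (Pc D) Y) (CC D Y)
      (ar (Sig D f) (Proj1 (CC D X) P Q'))
      (Sig_counit D f Q \<cdot>\<^bsub>Fib (Pc D) Y\<^esub> ar (Sig D f) (Proj2 (CC D X) P Q')))"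

locale temporal_doctrine =
  i: indexed_functor "Base D" "Mc D" "Pc D" "im D" +
  i': indexed_functor "Base D" "Mc' D" "Pc D" "im' D"
  for D :: "('c, 'f, 'm, 'ma, 'p, 'pa, 'n, 'na) tdoctrine" +
  assumes pt_terminal: "terminal (Base D) (pt D)"
    and P_cartesian_closed: "X \<in> Ob (Base D) \<Longrightarrow> cartesian_closed (Fib (Pc D) X) (CC D X)"
    and Sig_adjunction: "f \<in> hom (Base D) X Y \<Longrightarrow>
      adjunction (Fib (Pc D) X) (Fib (Pc D) Y) (Sig D f) (Sub (Pc D) f)
        (Sig_unit D f) (Sig_counit D f)"
    and Pi_adjoint: "f \<in> hom (Base D) X Y \<Longrightarrow>
      \<exists>Pi. adjoint (Fib (Pc D) Y) (Fib (Pc D) X) (Sub (Pc D) f) Pi"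
    and Dia_adjunction: "X \<in> Ob (Base D) \<Longrightarrow>
      adjunction (Fib (Pc D) X) (Fib (Mc D) X) (Dia D X) (at (im D) X)
        (Dia_unit D X) (Dia_counit D X)"
    and Dia_adjunction': "X \<in> Ob (Base D) \<Longrightarrow>
      adjunction (Fib (Pc D) X) (Fib (Mc' D) X) (Dia' D X) (at (im' D) X)
        (Dia_unit' D X) (Dia_counit' D X)"
    and Box_adjoint: "X \<in> Ob (Base D) \<Longrightarrow>
      \<exists>Box. adjoint (Fib (Mc D) X) (Fib (Pc D) X) (at (im D) X) Box"
    and Box_adjoint': "X \<in> Ob (Base D) \<Longrightarrow>
      \<exists>Box. adjoint (Fib (Mc' D) X) (Fib (Pc D) X) (at (im' D) X) Box"
    and comprehension: "X \<in> Ob (Base D) \<Longrightarrow>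
      \<exists>k. adjoint (over_cat (Base D) X) (Fib (Pc D) X) (canon D X) k \<and>
        fully_faithful (Fib (Pc D) X) (over_cat (Base D) X) k"
    and i_fully_faithful: "X \<in> Ob (Base D) \<Longrightarrow>
      fully_faithful (Fib (Mc D) X) (Fib (Pc D) X) (at (im D) X)"
    and i_fully_faithful': "X \<in> Ob (Base D) \<Longrightarrow>
      fully_faithful (Fib (Mc' D) X) (Fib (Pc D) X) (at (im' D) X)"
    and frobenius: "\<lbrakk>f \<in> hom (Base D) X Y; P \<in> Ob (Fib (Pc D) X); Q \<in> Ob (Fib (Pc D) Y)\<rbrakk> \<Longrightarrow>
      frobenius_map D f P Q \<in> iso (Fib (Pc D) Y)
        (ob (Sig D f) (Prod (CC D X) P (ob (Sub (Pc D) f) Q)))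
        (Prod (CC D Y) (ob (Sig D f) P) Q)"
    and mixed_frobenius:
      "\<lbrakk>X \<in> Ob (Base D); P \<in> Ob (Fib (Pc D) X); N \<in> Ob (Fib (Mc' D) X)\<rbrakk> \<Longrightarrow>
      ar (Dia D X) (prod_map (Fib (Pc D) X) (CC D X)
          (Dia_unit D X P) (Idt (Fib (Pc D) X) (ob (at (im' D) X) N)))
        \<in> iso (Fib (Mc D) X)
          (ob (Dia D X) (Prod (CC D X) P (ob (at (im' D) X) N)))
          (ob (Dia D X) (Prod (CC D X) (ob (at (im D) X) (ob (Dia D X) P)) (ob (at (im' D) X) N)))"
    and mixed_frobenius':
      "\<lbrakk>X \<in> Ob (Base D); P \<in> Ob (Fib (Pc D) X); M \<in> Ob (Fib (Mc D) X)\<rbrakk> \<Longrightarrow>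
      ar (Dia' D X) (prod_map (Fib (Pc D) X) (CC D X)
          (Dia_unit' D X P) (Idt (Fib (Pc D) X) (ob (at (im D) X) M)))
        \<in> iso (Fib (Mc' D) X)
          (ob (Dia' D X) (Prod (CC D X) P (ob (at (im D) X) M)))
          (ob (Dia' D X) (Prod (CC D X) (ob (at (im' D) X) (ob (Dia' D X) P)) (ob (at (im D) X) M)))"
    \<comment> \<open>As \<open>BB D X\<close> is a pullback up to isomorphism, invertibility of its projections at the
      terminal object is also taken up to natural isomorphism; a strict inverse would
      force the objects of \<open>Mc\<close> and \<open>Mc'\<close> there to have no nontrivial automorphisms.\<close>
    and j_invertible:
      "\<exists>J. quasi_inverse (BB D (pt D)) (Fib (Mc D) (pt D)) pb_fst J"
    and j_invertible':
      "\<exists>J. quasi_inverse (BB D (pt D)) (Fib (Mc' D) (pt D)) pb_snd J"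

section \<open>Derived notation\<close>

definition ex ::
  "('c, 'f, 'm, 'ma, 'p, 'pa, 'n, 'na) tdoctrine \<Rightarrow> 'f \<Rightarrow> ('m, 'ma, 'm, 'ma) func" where
  "ex D f = Dia D (Cod (Base D) f) \<odot> Sig D f \<odot> at (im D) (Dom (Base D) f)"

definition ex' ::
  "('c, 'f, 'm, 'ma, 'p, 'pa, 'n, 'na) tdoctrine \<Rightarrow> 'f \<Rightarrow> ('n, 'na, 'n, 'na) func" where
  "ex' D f = Dia' D (Cod (Base D) f) \<odot> Sig D f \<odot> at (im' D) (Dom (Base D) f)"

text \<open>The functor \<open>X\<^sup>* b\<^sub>1 : B 1 \<rightarrow> P X\<close>, whose adjoints are \<open>coend\<^sub>X\<close> and \<open>end\<^sub>X\<close>.\<close>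

definition const_b ::
  "('c, 'f, 'm, 'ma, 'p, 'pa, 'n, 'na) tdoctrine \<Rightarrow> 'c
   \<Rightarrow> (('m, 'n, 'pa) pb_ob, ('m, 'ma, 'n, 'na, 'pa) pb_ar, 'p, 'pa) func" where
  "const_b D X = Sub (Pc D) (to_terminal (Base D) (pt D) X) \<odot> bb D (pt D)"

definition is_coend ::
  "('c, 'f, 'm, 'ma, 'p, 'pa, 'n, 'na) tdoctrine \<Rightarrow> 'c
   \<Rightarrow> ('p, 'pa, ('m, 'n, 'pa) pb_ob, ('m, 'ma, 'n, 'na, 'pa) pb_ar) func \<Rightarrow> bool" where
  "is_coend D X co \<longleftrightarrow> adjoint (Fib (Pc D) X) (BB D (pt D)) co (const_b D X)"

definition is_end ::
  "('c, 'f, 'm, 'ma, 'p, 'pa, 'n, 'na) tdoctrine \<Rightarrow> 'c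
   \<Rightarrow> ('p, 'pa, ('m, 'n, 'pa) pb_ob, ('m, 'ma, 'n, 'na, 'pa) pb_ar) func \<Rightarrow> bool" where
  "is_end D X en \<longleftrightarrow> adjoint (BB D (pt D)) (Fib (Pc D) X) (const_b D X) en"

text \<open>
  The functors \<open>nat\<^sub>X(L, -)\<close>, \<open>nat'\<^sub>X(N, -)\<close>, \<open>ten\<^sub>X(N, -)\<close> and \<open>ten\<^sub>X(-, M)\<close>, relative to a
  choice of \<open>end\<^sub>X\<close> and \<open>coend\<^sub>X\<close>.
\<close>

definition nat_from ::
  "('c, 'f, 'm, 'ma, 'p, 'pa, 'n, 'na) tdoctrine \<Rightarrow> 'c \<Rightarrow> ('p, 'pa, 'b, 'ba) func \<Rightarrow> 'm
   \<Rightarrow> ('m, 'ma, 'b, 'ba) func" where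
  "nat_from D X en L =
     en \<odot> exp_func (Fib (Pc D) X) (CC D X) (ob (at (im D) X) L) \<odot> at (im D) X"

definition nat_from' ::
  "('c, 'f, 'm, 'ma, 'p, 'pa, 'n, 'na) tdoctrine \<Rightarrow> 'c \<Rightarrow> ('p, 'pa, 'b, 'ba) func \<Rightarrow> 'n
   \<Rightarrow> ('n, 'na, 'b, 'ba) func" where
  "nat_from' D X en N =
     en \<odot> exp_func (Fib (Pc D) X) (CC D X) (ob (at (im' D) X) N) \<odot> at (im' D) X"

definition ten_left ::
  "('c, 'f, 'm, 'ma, 'p, 'pa, 'n, 'na) tdoctrine \<Rightarrow> 'c \<Rightarrow> ('p, 'pa, 'b, 'ba) func \<Rightarrow> 'n
   \<Rightarrow> ('m, 'ma, 'b, 'ba) func" where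
  "ten_left D X co N =
     co \<odot> prod_left (Fib (Pc D) X) (CC D X) (ob (at (im' D) X) N) \<odot> at (im D) X"

definition ten_right ::
  "('c, 'f, 'm, 'ma, 'p, 'pa, 'n, 'na) tdoctrine \<Rightarrow> 'c \<Rightarrow> ('p, 'pa, 'b, 'ba) func \<Rightarrow> 'm
   \<Rightarrow> ('n, 'na, 'b, 'ba) func" where
  "ten_right D X co M =
     co \<odot> prod_right (Fib (Pc D) X) (CC D X) (ob (at (im D) X) M) \<odot> at (im' D) X"

text \<open>The slices \<open>X/x = \<exists>\<^sub>x \<top>\<^sub>1\<close> and \<open>x\X = \<exists>'\<^sub>x \<top>'\<^sub>1\<close>, for terminal objects \<open>t\<close>, \<open>t'\<close> of \<open>M 1\<close>, \<open>M' 1\<close>.\<close>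

definition left_slice :: "('c, 'f, 'm, 'ma, 'p, 'pa, 'n, 'na) tdoctrine \<Rightarrow> 'm \<Rightarrow> 'f \<Rightarrow> 'm" where
  "left_slice D t x = ob (ex D x) t"

definition right_slice :: "('c, 'f, 'm, 'ma, 'p, 'pa, 'n, 'na) tdoctrine \<Rightarrow> 'n \<Rightarrow> 'f \<Rightarrow> 'n" where
  "right_slice D t' x = ob (ex' D x) t'"

end

theory Submission
  imports Defs
begin

text \<open>
  By the Yoneda lemma it suffices to compare hom sets into \<open>nat\<^sub>X\<close> and out of \<open>ten\<^sub>X\<close>.
  For \<open>Q\<close> in \<open>P X\<close> the map \<open>\<gamma>\<^sub>Q : \<Sigma>\<^sub>x x\<^sup>* Q \<rightarrow> i (X/x) \<times> Q\<close>, whose components are \<open>\<Sigma>\<^sub>x\<close> of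
  \<open>x\<^sup>* Q \<rightarrow> 1\<close> followed by the unit of \<open>\<diamond>\<^sub>X\<close>, and the counit of \<open>\<Sigma>\<^sub>x\<close>, is natural in \<open>Q\<close>.
  By the Frobenius law it is isomorphic to the unit \<open>\<Sigma>\<^sub>x 1 \<rightarrow> i \<diamond>\<^sub>X \<Sigma>\<^sub>x 1\<close> times \<open>Q\<close>, so by the mixed
  Frobenius law \<open>\<diamond>\<^sub>X\<close> inverts it whenever \<open>Q\<close> lies in the image of \<open>i'\<close>; hence maps into objects
  in the image of \<open>i\<close> cannot distinguish its two sides.  Since \<open>X\<^sup>* b\<^sub>1\<close> takes values in both
  images and \<open>x\<^sup>* X\<^sup>* b\<^sub>1 \<cong> b\<^sub>1\<close>, this gives
  \<open>B 1 (B, j\<^sup>-\<^sup>1 (x \<cdot> M)) \<cong> P 1 (x\<^sup>* X\<^sup>* b B, x\<^sup>* i M) \<cong> P X (\<Sigma>\<^sub>x x\<^sup>* X\<^sup>* b B, i M)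
  \<cong> P X (X\<^sup>* b B \<times> i (X/x), i M) \<cong> B 1 (B, nat\<^sub>X (X/x, M))\<close>,
  and likewise, with \<open>\<diamond>'\<close> and \<open>Q = i M\<close>,
  \<open>B 1 (j\<^sup>-\<^sup>1 (x \<cdot> M), B) \<cong> P X (\<Sigma>\<^sub>x x\<^sup>* i M, X\<^sup>* b B) \<cong> P X (i' (x\X) \<times> i M, X\<^sup>* b B)
  \<cong> B 1 (ten\<^sub>X (x\X, M), B)\<close>.
\<close>

section \<open>Categories and natural isomorphisms\<close>

context category
begin

text \<open>Phrased with \<open>Ar\<close>, \<open>Dom\<close> and \<open>Cod\<close>, the axioms
  become conditional rewrite rules whose side conditions are what unfolding \<open>hom_def\<close>
  delivers. Most later equations between arrows are settled by that unfolding together with these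
  rules.\<close>

lemma Cmp_Ar [simp]: "\<lbrakk>f \<in> Ar C; g \<in> Ar C; Cod C f = Dom C g\<rbrakk> \<Longrightarrow> g \<cdot> f \<in> Ar C"
  and Dom_Cmp [simp]: "\<lbrakk>f \<in> Ar C; g \<in> Ar C; Cod C f = Dom C g\<rbrakk> \<Longrightarrow> Dom C (g \<cdot> f) = Dom C f"
  and Cod_Cmp [simp]: "\<lbrakk>f \<in> Ar C; g \<in> Ar C; Cod C f = Dom C g\<rbrakk> \<Longrightarrow> Cod C (g \<cdot> f) = Cod C g"
  using Cmp_hom[of f "Dom C f" "Dom C g" g "Cod C g"] by (simp_all add: hom_def)

lemma Idt_Ar [simp]: "A \<in> Ob C \<Longrightarrow> Idt C A \<in> Ar C"
  and Dom_Idt [simp]: "A \<in> Ob C \<Longrightarrow> Dom C (Idt C A) = A"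
  and Cod_Idt [simp]: "A \<in> Ob C \<Longrightarrow> Cod C (Idt C A) = A"
  using Idt_hom[of A] by (simp_all add: hom_def)

lemma Cmp_Idt [simp]: "\<lbrakk>f \<in> Ar C; Dom C f = A\<rbrakk> \<Longrightarrow> f \<cdot> Idt C A = f"
  and Idt_Cmp [simp]: "\<lbrakk>f \<in> Ar C; Cod C f = A\<rbrakk> \<Longrightarrow> Idt C A \<cdot> f = f"
  using Idt_right[of f A "Cod C f"] Idt_left[of f "Dom C f" A] by (simp_all add: hom_def)

lemma Cmp_assoc_right [simp]:
  "\<lbrakk>f \<in> Ar C; g \<in> Ar C; h \<in> Ar C; Cod C f = Dom C g; Cod C g = Dom C h\<rbrakk>
    \<Longrightarrow> (h \<cdot> g) \<cdot> f = h \<cdot> (g \<cdot> f)"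
  using Cmp_assoc[of f "Dom C f" "Dom C g" g "Dom C h" h "Cod C h"] by (simp add: hom_def)

lemma hom_Ob: "f \<in> hom C A B \<Longrightarrow> A \<in> Ob C \<and> B \<in> Ob C"
  using Dom_Ob Cod_Ob by (auto simp: hom_def)

text \<open>Rewriting associates composites to the right, so a cancelling pair gets hidden inside
  \<open>g \<cdot> (f \<cdot> h)\<close>; this form cancels it there.\<close>

lemma Cmp_inverse_left:
  "\<lbrakk>g \<cdot> f = Idt C A; f \<in> hom C A B; g \<in> hom C B A; h \<in> Ar C; Cod C h = A\<rbrakk> \<Longrightarrow> g \<cdot> (f \<cdot> h) = h"
  using Cmp_assoc_right[of h f g] by (simp add: hom_def)

lemma iso_Idt: "A \<in> Ob C \<Longrightarrow> Idt C A \<in> iso C A A"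
  unfolding iso_def by (rule CollectI, intro conjI bexI[of _ "Idt C A"]) (simp_all add: hom_def)

lemma iso_Cmp:
  assumes "f \<in> iso C A B" "g \<in> iso C B E"
  shows "g \<cdot> f \<in> iso C A E"
proof -
  obtain f' g' where *: "f' \<in> hom C B A" "f' \<cdot> f = Idt C A" "f \<cdot> f' = Idt C B"
      "g' \<in> hom C E B" "g' \<cdot> g = Idt C B" "g \<cdot> g' = Idt C E"
    using assms by (auto simp: iso_def)
  have fg: "f \<in> hom C A B" "g \<in> hom C B E"
    using assms by (auto simp: iso_def)
  have "(f' \<cdot> g') \<cdot> (g \<cdot> f) = Idt C A" "(g \<cdot> f) \<cdot> (f' \<cdot> g') = Idt C E"
    using * fg Cmp_inverse_left[OF *(5) fg(2) *(4), of f] Cmp_inverse_left[OF *(3) *(1) fg(1), of g']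
    by (simp_all add: hom_def)
  then show ?thesis
    using * fg Cmp_hom by (auto simp: iso_def intro!: bexI[of _ "f' \<cdot> g'"])
qed

lemma terminal_eq:
  "\<lbrakk>terminal C t; f \<in> hom C A t; g \<in> hom C A t\<rbrakk> \<Longrightarrow> f = g"
  using hom_Ob unfolding terminal_def by blast

lemma to_terminal_hom:
  "\<lbrakk>terminal C t; A \<in> Ob C\<rbrakk> \<Longrightarrow> to_terminal C t A \<in> hom C A t"
  unfolding terminal_def to_terminal_def by (metis theI')

end

lemma iso_hom: "f \<in> iso C A B \<Longrightarrow> f \<in> hom C A B"
  by (simp add: iso_def)

lemma iso_inverseE:
  assumes "f \<in> iso C A B"
  obtains g where "g \<in> iso C B A" "g \<cdot>\<^bsub>C\<^esub> f = Idt C A" "f \<cdot>\<^bsub>C\<^esub> g = Idt C B"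
  using assms unfolding iso_def by blast

context is_functor
begin

lemma ar_Ar [simp]: "f \<in> Ar A \<Longrightarrow> ar F f \<in> Ar B"
  and Dom_ar [simp]: "f \<in> Ar A \<Longrightarrow> Dom B (ar F f) = ob F (Dom A f)"
  and Cod_ar [simp]: "f \<in> Ar A \<Longrightarrow> Cod B (ar F f) = ob F (Cod A f)"
  using ar_hom[of f "Dom A f" "Cod A f"] by (simp_all add: hom_def)

lemma ar_Cmp_Ar [simp]:
  "\<lbrakk>f \<in> Ar A; g \<in> Ar A; Cod A f = Dom A g\<rbrakk> \<Longrightarrow> ar F (g \<cdot>\<^bsub>A\<^esub> f) = ar F g \<cdot>\<^bsub>B\<^esub> ar F f"
  using ar_Cmp[of f "Dom A f" "Dom A g" g "Cod A g"] by (simp add: hom_def)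

declare ob_Ob [simp] ar_Idt [simp]

lemma ar_iso:
  assumes "f \<in> iso A X Y"
  shows "ar F f \<in> iso B (ob F X) (ob F Y)"
proof -
  obtain g where g: "g \<in> hom A Y X" "g \<cdot>\<^bsub>A\<^esub> f = Idt A X" "f \<cdot>\<^bsub>A\<^esub> g = Idt A Y" and f: "f \<in> hom A X Y"
    using assms by (auto simp: iso_def)
  have "X \<in> Ob A" "Y \<in> Ob A"
    using A.hom_Ob[OF f] by auto
  then show ?thesis
    using ar_hom[OF f] ar_hom[OF g(1)] ar_Cmp[OF f g(1)] ar_Cmp[OF g(1) f] g
    by (auto simp: iso_def intro!: bexI[of _ "ar F g"])
qed

end

lemma ob_comp_func [simp]: "ob (G \<odot> F) A = ob G (ob F A)"
  and ar_comp_func [simp]: "ar (G \<odot> F) f = ar G (ar F f)"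
  by (simp_all add: comp_func_def)

lemma ob_id_func [simp]: "ob id_func A = A"
  and ar_id_func [simp]: "ar id_func f = f"
  by (simp_all add: id_func_def)

lemma comp_func_assoc: "(H \<odot> G) \<odot> F = H \<odot> G \<odot> F"
  by (simp add: comp_func_def)

lemma id_comp_func [simp]: "id_func \<odot> F = F"
  by (cases F) (simp add: comp_func_def)

lemma comp_id_func [simp]: "F \<odot> id_func = F"
  by (cases F) (simp add: comp_func_def)

lemma is_functor_id: "category A \<Longrightarrow> is_functor A A id_func"
  by (simp add: is_functor_def is_functor_axioms_def)

lemma is_functor_comp:
  assumes "is_functor A B F" "is_functor B K G"
  shows "is_functor A K (G \<odot> F)"
proof -
  interpret F: is_functor A B F by fact
  interpret G: is_functor B K G by fact
  show ?thesis
    by unfold_locales (auto simp: hom_def)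
qed

section \<open>Calculus of natural isomorphisms\<close>

lemma naturally_isomorphic_sym:
  assumes "naturally_isomorphic A B F G"
  shows "naturally_isomorphic A B G F"
proof -
  obtain \<tau> where "nat_iso A B F G \<tau>"
    using assms by (auto simp: naturally_isomorphic_def)
  then interpret nat_iso A B F G \<tau> .
  have "\<exists>u. u \<in> iso B (ob G X) (ob F X) \<and> u \<cdot>\<^bsub>B\<^esub> \<tau> X = Idt B (ob F X) \<and> \<tau> X \<cdot>\<^bsub>B\<^esub> u = Idt B (ob G X)"
    if "X \<in> Ob A" for X
    using iso_inverseE[OF component_iso[OF that]] by metis
  then obtain \<sigma> where \<sigma>: "\<And>X. X \<in> Ob A \<Longrightarrow> \<sigma> X \<in> iso B (ob G X) (ob F X)"
      "\<And>X. X \<in> Ob A \<Longrightarrow> \<sigma> X \<cdot>\<^bsub>B\<^esub> \<tau> X = Idt B (ob F X)"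
      "\<And>X. X \<in> Ob A \<Longrightarrow> \<tau> X \<cdot>\<^bsub>B\<^esub> \<sigma> X = Idt B (ob G X)"
    by metis
  have "\<sigma> Y \<cdot>\<^bsub>B\<^esub> ar G f = ar F f \<cdot>\<^bsub>B\<^esub> \<sigma> X" if f: "f \<in> hom A X Y" for f X Y
  proof -
    have XY: "X \<in> Ob A" "Y \<in> Ob A"
      using F.A.hom_Ob[OF f] by auto
    note h = iso_hom[OF \<sigma>(1)[OF XY(1)]] iso_hom[OF \<sigma>(1)[OF XY(2)]] component[OF XY(1)] component[OF XY(2)]
    \<comment> \<open>Insert \<open>\<tau> X\<close> after \<open>\<sigma> X\<close>, pass
      \<open>\<tau>\<close> through \<open>f\<close> by naturality, then cancel
      \<open>\<sigma> Y\<close> against \<open>\<tau> Y\<close>.\<close>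
    have "\<sigma> Y \<cdot>\<^bsub>B\<^esub> ar G f = \<sigma> Y \<cdot>\<^bsub>B\<^esub> ((ar G f \<cdot>\<^bsub>B\<^esub> \<tau> X) \<cdot>\<^bsub>B\<^esub> \<sigma> X)"
      using h f XY \<sigma>(3)[OF XY(1)] by (simp add: hom_def)
    also have "\<dots> = \<sigma> Y \<cdot>\<^bsub>B\<^esub> (\<tau> Y \<cdot>\<^bsub>B\<^esub> (ar F f \<cdot>\<^bsub>B\<^esub> \<sigma> X))"
      using h f XY by (simp add: naturality[OF f, symmetric]) (simp add: hom_def)
    also have "\<dots> = ar F f \<cdot>\<^bsub>B\<^esub> \<sigma> X"
      using h f by (intro F.B.Cmp_inverse_left[OF \<sigma>(2)[OF XY(2)]]) (auto simp: hom_def)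
    finally show ?thesis .
  qed
  then have "nat_iso A B G F \<sigma>"
    using \<sigma>(1) iso_hom[OF \<sigma>(1)] by unfold_locales
  then show ?thesis
    by (auto simp: naturally_isomorphic_def)
qed

lemma naturally_isomorphic_trans:
  assumes "naturally_isomorphic A B F G" "naturally_isomorphic A B G H"
  shows "naturally_isomorphic A B F H"
proof -
  obtain \<tau> \<sigma> where "nat_iso A B F G \<tau>" "nat_iso A B G H \<sigma>"
    using assms by (auto simp: naturally_isomorphic_def)
  then interpret \<tau>: nat_iso A B F G \<tau> + \<sigma>: nat_iso A B G H \<sigma>
    by auto
  have "nat_iso A B F H (\<lambda>X. \<sigma> X \<cdot>\<^bsub>B\<^esub> \<tau> X)"
  proof unfold_locales
    fix f X Y assume f: "f \<in> hom A X Y"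
    have XY: "X \<in> Ob A" "Y \<in> Ob A"
      using \<tau>.F.A.hom_Ob[OF f] by auto
    note h = \<tau>.component[OF XY(1)] \<tau>.component[OF XY(2)] \<sigma>.component[OF XY(1)] \<sigma>.component[OF XY(2)]
    have "(\<sigma> Y \<cdot>\<^bsub>B\<^esub> \<tau> Y) \<cdot>\<^bsub>B\<^esub> ar F f = \<sigma> Y \<cdot>\<^bsub>B\<^esub> (ar G f \<cdot>\<^bsub>B\<^esub> \<tau> X)"
      using h f by (simp add: \<tau>.naturality[OF f, symmetric]) (simp add: hom_def)
    also have "\<dots> = (\<sigma> Y \<cdot>\<^bsub>B\<^esub> ar G f) \<cdot>\<^bsub>B\<^esub> \<tau> X"
      using h f by (simp add: hom_def)
    also have "\<dots> = ar H f \<cdot>\<^bsub>B\<^esub> (\<sigma> X \<cdot>\<^bsub>B\<^esub> \<tau> X)"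
      using h f by (simp add: \<sigma>.naturality[OF f]) (simp add: hom_def)
    finally show "(\<sigma> Y \<cdot>\<^bsub>B\<^esub> \<tau> Y) \<cdot>\<^bsub>B\<^esub> ar F f = ar H f \<cdot>\<^bsub>B\<^esub> (\<sigma> X \<cdot>\<^bsub>B\<^esub> \<tau> X)" .
  qed (rule \<tau>.F.B.Cmp_hom[OF \<tau>.component \<sigma>.component] \<tau>.F.B.iso_Cmp[OF \<tau>.component_iso \<sigma>.component_iso];
      assumption)+
  then show ?thesis
    by (auto simp: naturally_isomorphic_def)
qed

lemma naturally_isomorphic_comp_right:
  assumes "naturally_isomorphic A B F G" "is_functor E A S"
  shows "naturally_isomorphic E B (F \<odot> S) (G \<odot> S)"
proof -
  obtain \<tau> where "nat_iso A B F G \<tau>"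
    using assms by (auto simp: naturally_isomorphic_def)
  then interpret nat_iso A B F G \<tau> .
  interpret S: is_functor E A S by fact
  interpret FS: is_functor E B "F \<odot> S" by (intro is_functor_comp) unfold_locales
  interpret GS: is_functor E B "G \<odot> S" by (intro is_functor_comp) unfold_locales
  have "nat_iso E B (F \<odot> S) (G \<odot> S) (\<lambda>X. \<tau> (ob S X))"
    using component component_iso naturality S.ar_hom by unfold_locales auto
  then show ?thesis
    by (auto simp: naturally_isomorphic_def)
qed

section \<open>Natural bijections of hom sets\<close>

text \<open>An isomorphism of profunctors on \<open>A\<close> and \<open>E\<close>. The ambient
  categories \<open>K\<close> and \<open>K'\<close> may differ, so that one chain can pass through
  adjunctions and fully faithful functors. Functoriality is bundled in so that links can be inverted
  and composed without restating it, and naturality is tested in both variables at once.\<close>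

definition hom_iso ::
  "('o, 'a) cat \<Rightarrow> ('e, 'ea) cat
   \<Rightarrow> ('k, 'ka) cat \<Rightarrow> ('o, 'a, 'k, 'ka) func \<Rightarrow> ('e, 'ea, 'k, 'ka) func
   \<Rightarrow> ('l, 'la) cat \<Rightarrow> ('o, 'a, 'l, 'la) func \<Rightarrow> ('e, 'ea, 'l, 'la) func \<Rightarrow> bool" where
  "hom_iso A E K F H K' F' H' \<longleftrightarrow>
     is_functor A K F \<and> is_functor E K H \<and> is_functor A K' F' \<and> is_functor E K' H' \<and>
     (\<exists>\<phi>. (\<forall>a \<in> Ob A. \<forall>e \<in> Ob E.
            bij_betw (\<phi> a e) (hom K (ob F a) (ob H e)) (hom K' (ob F' a) (ob H' e))) \<and>
          (\<forall>a a' e e'. \<forall>f \<in> hom A a' a. \<forall>g \<in> hom E e e'. \<forall>h \<in> hom K (ob F a) (ob H e).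
            \<phi> a' e' (ar H g \<cdot>\<^bsub>K\<^esub> (h \<cdot>\<^bsub>K\<^esub> ar F f)) = ar H' g \<cdot>\<^bsub>K'\<^esub> (\<phi> a e h \<cdot>\<^bsub>K'\<^esub> ar F' f)))"

lemma hom_isoI:
  assumes "is_functor A K F" "is_functor E K H" "is_functor A K' F'" "is_functor E K' H'"
    and "\<And>a e. \<lbrakk>a \<in> Ob A; e \<in> Ob E\<rbrakk> \<Longrightarrow>
      bij_betw (\<phi> a e) (hom K (ob F a) (ob H e)) (hom K' (ob F' a) (ob H' e))"
    and "\<And>a a' e e' f g h. \<lbrakk>f \<in> hom A a' a; g \<in> hom E e e'; h \<in> hom K (ob F a) (ob H e)\<rbrakk> \<Longrightarrow>
      \<phi> a' e' (ar H g \<cdot>\<^bsub>K\<^esub> (h \<cdot>\<^bsub>K\<^esub> ar F f)) = ar H' g \<cdot>\<^bsub>K'\<^esub> (\<phi> a e h \<cdot>\<^bsub>K'\<^esub> ar F' f)"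
  shows "hom_iso A E K F H K' F' H'"
  unfolding hom_iso_def using assms by (intro conjI exI[of _ \<phi>]) blast+

lemma hom_isoE:
  assumes "hom_iso A E K F H K' F' H'"
  obtains \<phi> where "is_functor A K F" "is_functor E K H" "is_functor A K' F'" "is_functor E K' H'"
    and "\<And>a e. \<lbrakk>a \<in> Ob A; e \<in> Ob E\<rbrakk> \<Longrightarrow>
      bij_betw (\<phi> a e) (hom K (ob F a) (ob H e)) (hom K' (ob F' a) (ob H' e))"
    and "\<And>a a' e e' f g h. \<lbrakk>f \<in> hom A a' a; g \<in> hom E e e'; h \<in> hom K (ob F a) (ob H e)\<rbrakk> \<Longrightarrow>
      \<phi> a' e' (ar H g \<cdot>\<^bsub>K\<^esub> (h \<cdot>\<^bsub>K\<^esub> ar F f)) = ar H' g \<cdot>\<^bsub>K'\<^esub> (\<phi> a e h \<cdot>\<^bsub>K'\<^esub> ar F' f)"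
  using assms unfolding hom_iso_def by metis

lemma hom_iso_sym:
  assumes "hom_iso A E K F H K' F' H'"
  shows "hom_iso A E K' F' H' K F H"
proof -
  obtain \<phi> where F: "is_functor A K F" and H: "is_functor E K H"
      and F': "is_functor A K' F'" and H': "is_functor E K' H'"
    and bij: "\<And>a e. \<lbrakk>a \<in> Ob A; e \<in> Ob E\<rbrakk> \<Longrightarrow>
      bij_betw (\<phi> a e) (hom K (ob F a) (ob H e)) (hom K' (ob F' a) (ob H' e))"
    and nat: "\<And>a a' e e' f g h. \<lbrakk>f \<in> hom A a' a; g \<in> hom E e e'; h \<in> hom K (ob F a) (ob H e)\<rbrakk> \<Longrightarrow>
      \<phi> a' e' (ar H g \<cdot>\<^bsub>K\<^esub> (h \<cdot>\<^bsub>K\<^esub> ar F f)) = ar H' g \<cdot>\<^bsub>K'\<^esub> (\<phi> a e h \<cdot>\<^bsub>K'\<^esub> ar F' f)"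
    by (rule hom_isoE[OF assms]) (rule that)
  interpret F: is_functor A K F by fact
  interpret H: is_functor E K H by fact
  define \<psi> where "\<psi> a e = inv_into (hom K (ob F a) (ob H e)) (\<phi> a e)" for a e
  show ?thesis
  proof (rule hom_isoI[OF F' H' F H, where \<phi> = \<psi>])
    fix a e assume "a \<in> Ob A" "e \<in> Ob E"
    then show "bij_betw (\<psi> a e) (hom K' (ob F' a) (ob H' e)) (hom K (ob F a) (ob H e))"
      unfolding \<psi>_def by (intro bij_betw_inv_into bij)
  next
    fix a a' e e' f g h
    assume f: "f \<in> hom A a' a" and g: "g \<in> hom E e e'" and h: "h \<in> hom K' (ob F' a) (ob H' e)"
    have obs: "a \<in> Ob A" "a' \<in> Ob A" "e \<in> Ob E" "e' \<in> Ob E"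
      using F.A.hom_Ob[OF f] H.A.hom_Ob[OF g] by auto
    have k: "\<psi> a e h \<in> hom K (ob F a) (ob H e)" "\<phi> a e (\<psi> a e h) = h"
      unfolding \<psi>_def using bij_betw_inv_into_right[OF bij h] bij_betw_inv_into[OF bij] h obs
      by (auto dest: bij_betwE)
    have "ar H g \<cdot>\<^bsub>K\<^esub> (\<psi> a e h \<cdot>\<^bsub>K\<^esub> ar F f) \<in> hom K (ob F a') (ob H e')"
      using k(1) f g by (simp add: hom_def)
    then show "\<psi> a' e' (ar H' g \<cdot>\<^bsub>K'\<^esub> (h \<cdot>\<^bsub>K'\<^esub> ar F' f)) = ar H g \<cdot>\<^bsub>K\<^esub> (\<psi> a e h \<cdot>\<^bsub>K\<^esub> ar F f)"
      using nat[OF f g k(1)] k(2) bij_betw_inv_into_left[OF bij[OF obs(2,4)]] unfolding \<psi>_def by metis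
  qed
qed

lemma hom_iso_trans [trans]:
  assumes "hom_iso A E K F H K' F' H'" "hom_iso A E K' F' H' K'' F'' H''"
  shows "hom_iso A E K F H K'' F'' H''"
proof -
  obtain \<phi> where F: "is_functor A K F" and H: "is_functor E K H"
      and F': "is_functor A K' F'" and H': "is_functor E K' H'"
    and bij: "\<And>a e. \<lbrakk>a \<in> Ob A; e \<in> Ob E\<rbrakk> \<Longrightarrow>
      bij_betw (\<phi> a e) (hom K (ob F a) (ob H e)) (hom K' (ob F' a) (ob H' e))"
    and nat: "\<And>a a' e e' f g h. \<lbrakk>f \<in> hom A a' a; g \<in> hom E e e'; h \<in> hom K (ob F a) (ob H e)\<rbrakk> \<Longrightarrow>
      \<phi> a' e' (ar H g \<cdot>\<^bsub>K\<^esub> (h \<cdot>\<^bsub>K\<^esub> ar F f)) = ar H' g \<cdot>\<^bsub>K'\<^esub> (\<phi> a e h \<cdot>\<^bsub>K'\<^esub> ar F' f)"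
    by (rule hom_isoE[OF assms(1)]) (rule that)
  obtain \<psi> where "is_functor A K' F'" "is_functor E K' H'"
      and F'': "is_functor A K'' F''" and H'': "is_functor E K'' H''"
    and bij': "\<And>a e. \<lbrakk>a \<in> Ob A; e \<in> Ob E\<rbrakk> \<Longrightarrow>
      bij_betw (\<psi> a e) (hom K' (ob F' a) (ob H' e)) (hom K'' (ob F'' a) (ob H'' e))"
    and nat': "\<And>a a' e e' f g h. \<lbrakk>f \<in> hom A a' a; g \<in> hom E e e'; h \<in> hom K' (ob F' a) (ob H' e)\<rbrakk> \<Longrightarrow>
      \<psi> a' e' (ar H' g \<cdot>\<^bsub>K'\<^esub> (h \<cdot>\<^bsub>K'\<^esub> ar F' f)) = ar H'' g \<cdot>\<^bsub>K''\<^esub> (\<psi> a e h \<cdot>\<^bsub>K''\<^esub> ar F'' f)"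
    by (rule hom_isoE[OF assms(2)]) (rule that)
  interpret F: is_functor A K F by fact
  interpret H: is_functor E K H by fact
  show ?thesis
  proof (rule hom_isoI[OF F H F'' H'', where \<phi> = "\<lambda>a e. \<psi> a e \<circ> \<phi> a e"])
    fix a a' e e' f g h
    assume f: "f \<in> hom A a' a" and g: "g \<in> hom E e e'" and h: "h \<in> hom K (ob F a) (ob H e)"
    have "\<phi> a e h \<in> hom K' (ob F' a) (ob H' e)"
      using bij F.A.hom_Ob[OF f] H.A.hom_Ob[OF g] h by (blast dest: bij_betwE)
    then show "(\<psi> a' e' \<circ> \<phi> a' e') (ar H g \<cdot>\<^bsub>K\<^esub> (h \<cdot>\<^bsub>K\<^esub> ar F f)) =
        ar H'' g \<cdot>\<^bsub>K''\<^esub> ((\<psi> a e \<circ> \<phi> a e) h \<cdot>\<^bsub>K''\<^esub> ar F'' f)"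
      using nat[OF f g h] nat'[OF f g] by simp
  qed (rule bij_betw_trans[OF bij bij'])
qed

text \<open>Transposition applies \<open>G\<close> and precomposes with the unit; its inverse
  applies \<open>F\<close> and postcomposes with the counit. Naturality and one triangle identity
  settle each round trip. The functors \<open>S\<close> and \<open>T\<close> are carried along so
  that the bijection can serve as a link inside a longer chain.\<close>

lemma hom_iso_adjunction:
  assumes "adjunction A B F G \<eta> \<epsilon>" and S: "is_functor A' A S" and T: "is_functor E B T"
  shows "hom_iso A' E B (F \<odot> S) T A S (G \<odot> T)"
proof -
  interpret adjunction A B F G \<eta> \<epsilon> by fact
  interpret F: is_functor A B F by (rule left_functor)
  interpret G: is_functor B A G by (rule right_functor)
  interpret S: is_functor A' A S by fact
  interpret T: is_functor E B T by fact
  show ?thesis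
  proof (rule hom_isoI[OF _ T S, where \<phi> = "\<lambda>a e h. ar G h \<cdot>\<^bsub>A\<^esub> \<eta> (ob S a)"])
    show "is_functor A' B (F \<odot> S)" "is_functor E A (G \<odot> T)"
      by (rule is_functor_comp; unfold_locales)+
  next
    fix a e assume ae: "a \<in> Ob A'" "e \<in> Ob E"
    then have o: "ob S a \<in> Ob A" "ob T e \<in> Ob B"
      by auto
    note c = unit.component[OF o(1)] counit.component[OF o(2)]
    show "bij_betw (\<lambda>h. ar G h \<cdot>\<^bsub>A\<^esub> \<eta> (ob S a)) (hom B (ob (F \<odot> S) a) (ob T e)) (hom A (ob S a) (ob (G \<odot> T) e))"
    proof (rule bij_betw_byWitness[where f' = "\<lambda>k. \<epsilon> (ob T e) \<cdot>\<^bsub>B\<^esub> ar F k"])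
      show "\<forall>h \<in> hom B (ob (F \<odot> S) a) (ob T e). \<epsilon> (ob T e) \<cdot>\<^bsub>B\<^esub> ar F (ar G h \<cdot>\<^bsub>A\<^esub> \<eta> (ob S a)) = h"
      proof
        fix h assume h: "h \<in> hom B (ob (F \<odot> S) a) (ob T e)"
        have "ob F (ob S a) \<in> Ob B" using o by simp
        note d = counit.component[OF this]
        have "\<epsilon> (ob T e) \<cdot>\<^bsub>B\<^esub> ar F (ar G h \<cdot>\<^bsub>A\<^esub> \<eta> (ob S a)) = (\<epsilon> (ob T e) \<cdot>\<^bsub>B\<^esub> ar (F \<odot> G) h) \<cdot>\<^bsub>B\<^esub> ar F (\<eta> (ob S a))"
          using h c o by (simp add: hom_def)
        also have "\<dots> = h \<cdot>\<^bsub>B\<^esub> (\<epsilon> (ob F (ob S a)) \<cdot>\<^bsub>B\<^esub> ar F (\<eta> (ob S a)))"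
          using h c d counit.naturality[of h "ob F (ob S a)" "ob T e"] by (simp add: hom_def)
        also have "\<dots> = h"
          using h triangle_left[OF o(1)] by (simp add: hom_def)
        finally show "\<epsilon> (ob T e) \<cdot>\<^bsub>B\<^esub> ar F (ar G h \<cdot>\<^bsub>A\<^esub> \<eta> (ob S a)) = h" .
      qed
      show "\<forall>k \<in> hom A (ob S a) (ob (G \<odot> T) e). ar G (\<epsilon> (ob T e) \<cdot>\<^bsub>B\<^esub> ar F k) \<cdot>\<^bsub>A\<^esub> \<eta> (ob S a) = k"
      proof
        fix k assume k: "k \<in> hom A (ob S a) (ob (G \<odot> T) e)"
        have "ob G (ob T e) \<in> Ob A" using o by simp
        note d = unit.component[OF this]
        have "ar G (\<epsilon> (ob T e) \<cdot>\<^bsub>B\<^esub> ar F k) \<cdot>\<^bsub>A\<^esub> \<eta> (ob S a) = ar G (\<epsilon> (ob T e)) \<cdot>\<^bsub>A\<^esub> (ar (G \<odot> F) k \<cdot>\<^bsub>A\<^esub> \<eta> (ob S a))"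
          using k c by (simp add: hom_def)
        also have "\<dots> = (ar G (\<epsilon> (ob T e)) \<cdot>\<^bsub>A\<^esub> \<eta> (ob G (ob T e))) \<cdot>\<^bsub>A\<^esub> k"
          using k c d unit.naturality[of k "ob S a" "ob G (ob T e)"] by (simp add: hom_def)
        also have "\<dots> = k"
          using k triangle_right[OF o(2)] by (simp add: hom_def)
        finally show "ar G (\<epsilon> (ob T e) \<cdot>\<^bsub>B\<^esub> ar F k) \<cdot>\<^bsub>A\<^esub> \<eta> (ob S a) = k" .
      qed
    qed (use c in \<open>auto simp: hom_def\<close>)
  next
    fix a a' e e' f g h
    assume f: "f \<in> hom A' a' a" and g: "g \<in> hom E e e'" and h: "h \<in> hom B (ob (F \<odot> S) a) (ob T e)"
    have o: "ob S a \<in> Ob A" "ob S a' \<in> Ob A"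
      using S.A.hom_Ob[OF f] by auto
    show "ar G (ar T g \<cdot>\<^bsub>B\<^esub> (h \<cdot>\<^bsub>B\<^esub> ar (F \<odot> S) f)) \<cdot>\<^bsub>A\<^esub> \<eta> (ob S a') =
       ar (G \<odot> T) g \<cdot>\<^bsub>A\<^esub> ((ar G h \<cdot>\<^bsub>A\<^esub> \<eta> (ob S a)) \<cdot>\<^bsub>A\<^esub> ar S f)"
      using f g h unit.component[OF o(1)] unit.component[OF o(2)] unit.naturality[OF S.ar_hom[OF f]]
      by (simp add: hom_def)
  qed
qed

lemma hom_iso_fully_faithful:
  assumes ff: "fully_faithful A B I" and I: "is_functor A B I"
    and S: "is_functor A' A S" and T: "is_functor E A T"
  shows "hom_iso A' E A S T B (I \<odot> S) (I \<odot> T)"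
proof (rule hom_isoI[OF S T is_functor_comp[OF S I] is_functor_comp[OF T I], where \<phi> = "\<lambda>a e. ar I"])
  interpret I: is_functor A B I by fact
  interpret S: is_functor A' A S by fact
  interpret T: is_functor E A T by fact
  show "bij_betw (ar I) (hom A (ob S a) (ob T e)) (hom B (ob (I \<odot> S) a) (ob (I \<odot> T) e))"
    if "a \<in> Ob A'" "e \<in> Ob E" for a e
    using ff that by (simp add: fully_faithful_def)
  show "ar I (ar T g \<cdot>\<^bsub>A\<^esub> (h \<cdot>\<^bsub>A\<^esub> ar S f)) = ar (I \<odot> T) g \<cdot>\<^bsub>B\<^esub> (ar I h \<cdot>\<^bsub>B\<^esub> ar (I \<odot> S) f)"
    if "f \<in> hom A' a' a" "g \<in> hom E e e'" "h \<in> hom A (ob S a) (ob T e)" for a a' e e' f g h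
    using that by (simp add: hom_def)
qed

text \<open>The transformation \<open>\<tau>\<close> may fail to be invertible; it only has to look
  invertible to the objects \<open>ob H e\<close>. This is what admits \<gamma> as a link of a
  chain. Precomposition is contravariant, so the result runs from \<open>F'\<close> to
  \<open>F\<close>.\<close>

lemma hom_iso_precomp:
  assumes "nat_trans A K F F' \<tau>" and H: "is_functor E K H"
    and "\<And>a e. \<lbrakk>a \<in> Ob A; e \<in> Ob E\<rbrakk> \<Longrightarrow>
      bij_betw (\<lambda>h. h \<cdot>\<^bsub>K\<^esub> \<tau> a) (hom K (ob F' a) (ob H e)) (hom K (ob F a) (ob H e))"
  shows "hom_iso A E K F' H K F H"
proof -
  interpret nat_trans A K F F' \<tau> by fact
  interpret H: is_functor E K H by fact
  show ?thesis
  proof (rule hom_isoI[OF G.is_functor_axioms H F.is_functor_axioms H, where \<phi> = "\<lambda>a e h. h \<cdot>\<^bsub>K\<^esub> \<tau> a"])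
    show "(ar H g \<cdot>\<^bsub>K\<^esub> (h \<cdot>\<^bsub>K\<^esub> ar F' f)) \<cdot>\<^bsub>K\<^esub> \<tau> a' = ar H g \<cdot>\<^bsub>K\<^esub> ((h \<cdot>\<^bsub>K\<^esub> \<tau> a) \<cdot>\<^bsub>K\<^esub> ar F f)"
      if "f \<in> hom A a' a" "g \<in> hom E e e'" "h \<in> hom K (ob F' a) (ob H e)" for a a' e e' f g h
      using that component[of a] component[of a'] naturality[of f a' a] F.A.hom_Ob[of f a' a]
      by (simp add: hom_def)
  qed (rule assms)
qed

text \<open>In the terminology of localizations, \<open>Z\<close> is local for
  \<open>u\<close>.\<close>

definition precomp_bij :: "('o, 'a) cat \<Rightarrow> 'o \<Rightarrow> 'o \<Rightarrow> 'o \<Rightarrow> 'a \<Rightarrow> bool" where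
  "precomp_bij K A B Z u \<longleftrightarrow>
     u \<in> hom K A B \<and> bij_betw (\<lambda>h. h \<cdot>\<^bsub>K\<^esub> u) (hom K B Z) (hom K A Z)"

context category
begin

lemma precomp_bij_iso:
  assumes u: "u \<in> iso C A B"
  shows "precomp_bij C A B Z u"
proof -
  obtain v where v: "v \<in> iso C B A" "v \<cdot> u = Idt C A" "u \<cdot> v = Idt C B"
    using iso_inverseE[OF u] .
  note uv = iso_hom[OF u] iso_hom[OF v(1)]
  have "bij_betw (\<lambda>h. h \<cdot> u) (hom C B Z) (hom C A Z)"
    using v(2,3) uv by (intro bij_betw_byWitness[where f' = "\<lambda>h. h \<cdot> v"]) (auto simp: hom_def)
  then show ?thesis
    using uv by (simp add: precomp_bij_def)
qed

lemma precomp_bij_Cmp: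
  assumes "precomp_bij C A B Z u" "precomp_bij C B E Z v"
  shows "precomp_bij C A E Z (v \<cdot> u)"
proof -
  have uv: "u \<in> hom C A B" "v \<in> hom C B E"
    using assms by (auto simp: precomp_bij_def)
  have "bij_betw ((\<lambda>h. h \<cdot> u) \<circ> (\<lambda>h. h \<cdot> v)) (hom C E Z) (hom C A Z)"
    using assms by (auto simp: precomp_bij_def intro: bij_betw_trans)
  moreover have "((\<lambda>h. h \<cdot> u) \<circ> (\<lambda>h. h \<cdot> v)) h = h \<cdot> (v \<cdot> u)" if "h \<in> hom C E Z" for h
    using that uv by (simp add: hom_def)
  ultimately show ?thesis
    using uv Cmp_hom by (auto simp: precomp_bij_def cong: bij_betw_cong)
qed

lemma precomp_bij_target_iso:
  assumes w: "w \<in> iso C Z W" and u: "precomp_bij C A B Z u"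
  shows "precomp_bij C A B W u"
proof -
  obtain w' where w': "w' \<in> iso C W Z" "w' \<cdot> w = Idt C Z" "w \<cdot> w' = Idt C W"
    using iso_inverseE[OF w] .
  note h = iso_hom[OF w] iso_hom[OF w'(1)]
  have inv: "w \<cdot> (w' \<cdot> f) = f" if "f \<in> Ar C" "Cod C f = W" for f
    using Cmp_inverse_left[OF w'(3) h(2,1) that] .
  have inv': "w' \<cdot> (w \<cdot> f) = f" if "f \<in> Ar C" "Cod C f = Z" for f
    using Cmp_inverse_left[OF w'(2) h that] .
  have post: "bij_betw (\<lambda>h. w \<cdot> h) (hom C X Z) (hom C X W)"
    "bij_betw (\<lambda>h. w' \<cdot> h) (hom C X W) (hom C X Z)" for X
    using h inv inv'
    by (intro bij_betw_byWitness[where f' = "\<lambda>h. w' \<cdot> h"] bij_betw_byWitness[where f' = "\<lambda>h. w \<cdot> h"];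
        auto simp: hom_def)+
  have uh: "u \<in> hom C A B"
    using u by (simp add: precomp_bij_def)
  \<comment> \<open>On arrows into \<open>W\<close>, precomposition with \<open>u\<close> is its
    counterpart on arrows into \<open>Z\<close>, conjugated by postcomposition with
    \<open>w\<close>.\<close>
  have "bij_betw ((\<lambda>h. w \<cdot> h) \<circ> (\<lambda>h. h \<cdot> u) \<circ> (\<lambda>h. w' \<cdot> h)) (hom C B W) (hom C A W)"
    using u post by (auto simp: precomp_bij_def intro: bij_betw_trans)
  moreover have "((\<lambda>h. w \<cdot> h) \<circ> (\<lambda>h. h \<cdot> u) \<circ> (\<lambda>h. w' \<cdot> h)) f = f \<cdot> u" if "f \<in> hom C B W" for f
    using that uh h inv[of "f \<cdot> u"] by (simp add: hom_def)
  ultimately show ?thesis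
    using uh by (simp add: precomp_bij_def cong: bij_betw_cong)
qed

end

section \<open>Replacing a functor in a hom bijection by an isomorphic one\<close>

lemma hom_iso_left:
  assumes F: "naturally_isomorphic A K F F'" and H: "is_functor E K H"
  shows "hom_iso A E K F H K F' H"
proof -
  \<comment> \<open>The isomorphism is inverted first because \<open>hom_iso_precomp\<close> leads
    from the target functor of the transformation to its source.\<close>
  obtain \<tau> where "nat_iso A K F' F \<tau>"
    using naturally_isomorphic_sym[OF F] by (auto simp: naturally_isomorphic_def)
  then interpret nat_iso A K F' F \<tau> .
  show ?thesis
    using F.B.precomp_bij_iso[OF component_iso]
    by (intro hom_iso_precomp[OF nat_trans_axioms H]) (auto simp: precomp_bij_def)
qed

lemma hom_iso_right:
  assumes H: "naturally_isomorphic E K H H'" and F: "is_functor A K F"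
  shows "hom_iso A E K F H K F H'"
proof -
  obtain \<tau> where "nat_iso E K H H' \<tau>"
    using H by (auto simp: naturally_isomorphic_def)
  then interpret nat_iso E K H H' \<tau> .
  interpret I: is_functor A K F by fact
  show ?thesis
  proof (rule hom_isoI[OF I.is_functor_axioms F.is_functor_axioms I.is_functor_axioms G.is_functor_axioms,
        where \<phi> = "\<lambda>a e h. \<tau> e \<cdot>\<^bsub>K\<^esub> h"])
    fix a e assume e: "e \<in> Ob E"
    obtain u where u: "u \<in> iso K (ob H' e) (ob H e)" "u \<cdot>\<^bsub>K\<^esub> \<tau> e = Idt K (ob H e)"
        "\<tau> e \<cdot>\<^bsub>K\<^esub> u = Idt K (ob H' e)"
      using iso_inverseE[OF component_iso[OF e]] .
    note h = component[OF e] iso_hom[OF u(1)]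
    show "bij_betw (\<lambda>h. \<tau> e \<cdot>\<^bsub>K\<^esub> h) (hom K (ob F a) (ob H e)) (hom K (ob F a) (ob H' e))"
      using h F.B.Cmp_inverse_left[OF u(2) h] F.B.Cmp_inverse_left[OF u(3) h(2,1)]
      by (intro bij_betw_byWitness[where f' = "\<lambda>h. u \<cdot>\<^bsub>K\<^esub> h"]) (auto simp: hom_def)
  next
    fix a a' e e' f g h
    assume f: "f \<in> hom A a' a" and g: "g \<in> hom E e e'" and h: "h \<in> hom K (ob F a) (ob H e)"
    have e: "e \<in> Ob E" "e' \<in> Ob E"
      using F.A.hom_Ob[OF g] by auto
    note c = component[OF e(1)] component[OF e(2)]
    have "\<tau> e' \<cdot>\<^bsub>K\<^esub> (ar H g \<cdot>\<^bsub>K\<^esub> (h \<cdot>\<^bsub>K\<^esub> ar F f)) = (\<tau> e' \<cdot>\<^bsub>K\<^esub> ar H g) \<cdot>\<^bsub>K\<^esub> (h \<cdot>\<^bsub>K\<^esub> ar F f)"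
      using c f g h by (simp add: hom_def)
    also have "\<dots> = ar H' g \<cdot>\<^bsub>K\<^esub> ((\<tau> e \<cdot>\<^bsub>K\<^esub> h) \<cdot>\<^bsub>K\<^esub> ar F f)"
      using c f g h by (simp add: naturality[OF g]) (simp add: hom_def)
    finally show "\<tau> e' \<cdot>\<^bsub>K\<^esub> (ar H g \<cdot>\<^bsub>K\<^esub> (h \<cdot>\<^bsub>K\<^esub> ar F f)) = ar H' g \<cdot>\<^bsub>K\<^esub> ((\<tau> e \<cdot>\<^bsub>K\<^esub> h) \<cdot>\<^bsub>K\<^esub> ar F f)" .
  qed
qed

section \<open>Cartesian closed categories\<close>

context cartesian_closed
begin

declare Prod_Ob [simp] Exp_Ob [simp]

lemma Proj_Ar [simp]:
  assumes "A \<in> Ob K" "B \<in> Ob K"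
  shows "Proj1 S A B \<in> Ar K" "Dom K (Proj1 S A B) = Prod S A B" "Cod K (Proj1 S A B) = A"
    "Proj2 S A B \<in> Ar K" "Dom K (Proj2 S A B) = Prod S A B" "Cod K (Proj2 S A B) = B"
  using Proj1_hom[OF assms] Proj2_hom[OF assms] by (auto simp: hom_def)

lemma prod_eqI:
  assumes "h \<in> hom K T (Prod S A B)" "h' \<in> hom K T (Prod S A B)" "A \<in> Ob K" "B \<in> Ob K"
    and "Proj1 S A B \<cdot>\<^bsub>K\<^esub> h = Proj1 S A B \<cdot>\<^bsub>K\<^esub> h'" "Proj2 S A B \<cdot>\<^bsub>K\<^esub> h = Proj2 S A B \<cdot>\<^bsub>K\<^esub> h'"
  shows "h = h'"
proof -
  have "Proj1 S A B \<cdot>\<^bsub>K\<^esub> h' \<in> hom K T A" "Proj2 S A B \<cdot>\<^bsub>K\<^esub> h' \<in> hom K T B"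
    using assms by (auto simp: hom_def)
  from Prod_universal[OF this] show ?thesis
    using assms by metis
qed

lemma pairing:
  assumes "f \<in> hom K T A" "g \<in> hom K T B"
  shows pairing_hom: "pairing K S f g \<in> hom K T (Prod S A B)"
    and Proj1_pairing: "Proj1 S A B \<cdot>\<^bsub>K\<^esub> pairing K S f g = f"
    and Proj2_pairing: "Proj2 S A B \<cdot>\<^bsub>K\<^esub> pairing K S f g = g"
  using theI'[OF Prod_universal[OF assms]] assms
  by (simp_all add: pairing_def hom_def)

lemma prod_map:
  assumes "f \<in> hom K A A'" "g \<in> hom K B B'"
  shows prod_map_hom: "prod_map K S f g \<in> hom K (Prod S A B) (Prod S A' B')"
    and Proj1_prod_map: "Proj1 S A' B' \<cdot>\<^bsub>K\<^esub> prod_map K S f g = f \<cdot>\<^bsub>K\<^esub> Proj1 S A B"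
    and Proj2_prod_map: "Proj2 S A' B' \<cdot>\<^bsub>K\<^esub> prod_map K S f g = g \<cdot>\<^bsub>K\<^esub> Proj2 S A B"
proof -
  have o: "A \<in> Ob K" "B \<in> Ob K"
    using assms hom_Ob by blast+
  have "f \<cdot>\<^bsub>K\<^esub> Proj1 S A B \<in> hom K (Prod S A B) A'" "g \<cdot>\<^bsub>K\<^esub> Proj2 S A B \<in> hom K (Prod S A B) B'"
    using assms o by (simp_all add: hom_def)
  note p = pairing[OF this]
  show "prod_map K S f g \<in> hom K (Prod S A B) (Prod S A' B')"
    "Proj1 S A' B' \<cdot>\<^bsub>K\<^esub> prod_map K S f g = f \<cdot>\<^bsub>K\<^esub> Proj1 S A B"
    "Proj2 S A' B' \<cdot>\<^bsub>K\<^esub> prod_map K S f g = g \<cdot>\<^bsub>K\<^esub> Proj2 S A B"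
    using p assms by (simp_all add: prod_map_def hom_def)
qed

text \<open>The projection law with a further arrow appended, the form that occurs in composites
  associated to the right.\<close>

lemma Proj1_prod_map_Cmp:
  assumes "f \<in> hom K A A'" "g \<in> hom K B B'" "h \<in> hom K T (Prod S A B)"
  shows "Proj1 S A' B' \<cdot>\<^bsub>K\<^esub> (prod_map K S f g \<cdot>\<^bsub>K\<^esub> h) = f \<cdot>\<^bsub>K\<^esub> (Proj1 S A B \<cdot>\<^bsub>K\<^esub> h)"
proof -
  have "A \<in> Ob K" "B \<in> Ob K" "A' \<in> Ob K" "B' \<in> Ob K"
    using assms hom_Ob by blast+
  then show ?thesis
    using arg_cong[OF Proj1_prod_map[OF assms(1,2)], of "\<lambda>k. k \<cdot>\<^bsub>K\<^esub> h"] assms prod_map_hom[OF assms(1,2)]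
    by (simp add: hom_def)
qed

lemma Proj2_prod_map_Cmp:
  assumes "f \<in> hom K A A'" "g \<in> hom K B B'" "h \<in> hom K T (Prod S A B)"
  shows "Proj2 S A' B' \<cdot>\<^bsub>K\<^esub> (prod_map K S f g \<cdot>\<^bsub>K\<^esub> h) = g \<cdot>\<^bsub>K\<^esub> (Proj2 S A B \<cdot>\<^bsub>K\<^esub> h)"
proof -
  have "A \<in> Ob K" "B \<in> Ob K" "A' \<in> Ob K" "B' \<in> Ob K"
    using assms hom_Ob by blast+
  then show ?thesis
    using arg_cong[OF Proj2_prod_map[OF assms(1,2)], of "\<lambda>k. k \<cdot>\<^bsub>K\<^esub> h"] assms prod_map_hom[OF assms(1,2)]
    by (simp add: hom_def)
qed

lemma prod_map_pairing:
  assumes "f \<in> hom K A A'" "g \<in> hom K B B'" "h \<in> hom K T A" "k \<in> hom K T B"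
  shows "prod_map K S f g \<cdot>\<^bsub>K\<^esub> pairing K S h k = pairing K S (f \<cdot>\<^bsub>K\<^esub> h) (g \<cdot>\<^bsub>K\<^esub> k)"
proof (rule prod_eqI)
  have "f \<cdot>\<^bsub>K\<^esub> h \<in> hom K T A'" "g \<cdot>\<^bsub>K\<^esub> k \<in> hom K T B'"
    using assms Cmp_hom by blast+
  note p = pairing[OF this] and q = pairing[OF assms(3,4)]
  show "pairing K S (f \<cdot>\<^bsub>K\<^esub> h) (g \<cdot>\<^bsub>K\<^esub> k) \<in> hom K T (Prod S A' B')"
    "prod_map K S f g \<cdot>\<^bsub>K\<^esub> pairing K S h k \<in> hom K T (Prod S A' B')"
    by (rule p Cmp_hom[OF q(1) prod_map_hom[OF assms(1,2)]])+
  show "A' \<in> Ob K" "B' \<in> Ob K"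
    using assms hom_Ob by blast+
  show "Proj1 S A' B' \<cdot>\<^bsub>K\<^esub> (prod_map K S f g \<cdot>\<^bsub>K\<^esub> pairing K S h k) = Proj1 S A' B' \<cdot>\<^bsub>K\<^esub> pairing K S (f \<cdot>\<^bsub>K\<^esub> h) (g \<cdot>\<^bsub>K\<^esub> k)"
    "Proj2 S A' B' \<cdot>\<^bsub>K\<^esub> (prod_map K S f g \<cdot>\<^bsub>K\<^esub> pairing K S h k) = Proj2 S A' B' \<cdot>\<^bsub>K\<^esub> pairing K S (f \<cdot>\<^bsub>K\<^esub> h) (g \<cdot>\<^bsub>K\<^esub> k)"
    by (simp_all add: p q Proj1_prod_map_Cmp[OF assms(1,2) q(1)] Proj2_prod_map_Cmp[OF assms(1,2) q(1)])
qed

lemma pairing_Cmp: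
  assumes "h \<in> hom K T A" "k \<in> hom K T B" "u \<in> hom K W T"
  shows "pairing K S h k \<cdot>\<^bsub>K\<^esub> u = pairing K S (h \<cdot>\<^bsub>K\<^esub> u) (k \<cdot>\<^bsub>K\<^esub> u)"
proof (rule prod_eqI)
  have hk: "h \<cdot>\<^bsub>K\<^esub> u \<in> hom K W A" "k \<cdot>\<^bsub>K\<^esub> u \<in> hom K W B"
    using assms Cmp_hom by blast+
  note p = pairing[OF hk] and q = pairing[OF assms(1,2)]
  show "pairing K S (h \<cdot>\<^bsub>K\<^esub> u) (k \<cdot>\<^bsub>K\<^esub> u) \<in> hom K W (Prod S A B)"
    "pairing K S h k \<cdot>\<^bsub>K\<^esub> u \<in> hom K W (Prod S A B)"
    by (rule p Cmp_hom[OF assms(3) q(1)])+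
  show o: "A \<in> Ob K" "B \<in> Ob K"
    using assms hom_Ob by blast+
  show "Proj1 S A B \<cdot>\<^bsub>K\<^esub> (pairing K S h k \<cdot>\<^bsub>K\<^esub> u) = Proj1 S A B \<cdot>\<^bsub>K\<^esub> pairing K S (h \<cdot>\<^bsub>K\<^esub> u) (k \<cdot>\<^bsub>K\<^esub> u)"
    using Cmp_assoc[OF assms(3) q(1) Proj1_hom[OF o]] by (simp add: p q)
  show "Proj2 S A B \<cdot>\<^bsub>K\<^esub> (pairing K S h k \<cdot>\<^bsub>K\<^esub> u) = Proj2 S A B \<cdot>\<^bsub>K\<^esub> pairing K S (h \<cdot>\<^bsub>K\<^esub> u) (k \<cdot>\<^bsub>K\<^esub> u)"
    using Cmp_assoc[OF assms(3) q(1) Proj2_hom[OF o]] by (simp add: p q)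
qed

lemma prod_map_Cmp:
  assumes "f \<in> hom K A A'" "f' \<in> hom K A' A''" "g \<in> hom K B B'" "g' \<in> hom K B' B''"
  shows "prod_map K S f' g' \<cdot>\<^bsub>K\<^esub> prod_map K S f g = prod_map K S (f' \<cdot>\<^bsub>K\<^esub> f) (g' \<cdot>\<^bsub>K\<^esub> g)"
proof -
  have "A \<in> Ob K" "B \<in> Ob K"
    using assms hom_Ob by blast+
  moreover from this have "f \<cdot>\<^bsub>K\<^esub> Proj1 S A B \<in> hom K (Prod S A B) A'" "g \<cdot>\<^bsub>K\<^esub> Proj2 S A B \<in> hom K (Prod S A B) B'"
    using assms by (simp_all add: hom_def)
  from prod_map_pairing[OF assms(2,4) this] show ?thesis
    using assms calculation by (simp add: prod_map_def hom_def)
qed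

lemma prod_map_Idt:
  assumes "A \<in> Ob K" "B \<in> Ob K"
  shows "prod_map K S (Idt K A) (Idt K B) = Idt K (Prod S A B)"
  by (rule prod_eqI[of _ "Prod S A B" A B]) (use assms in \<open>simp_all add: Idt_hom prod_map[OF Idt_hom Idt_hom]\<close>)

lemma prod_map_iso:
  assumes "f \<in> iso K A A'" "g \<in> iso K B B'"
  shows "prod_map K S f g \<in> iso K (Prod S A B) (Prod S A' B')"
proof -
  obtain f' g' where *: "f' \<in> iso K A' A" "f' \<cdot>\<^bsub>K\<^esub> f = Idt K A" "f \<cdot>\<^bsub>K\<^esub> f' = Idt K A'"
      "g' \<in> iso K B' B" "g' \<cdot>\<^bsub>K\<^esub> g = Idt K B" "g \<cdot>\<^bsub>K\<^esub> g' = Idt K B'"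
    using iso_inverseE[OF assms(1)] iso_inverseE[OF assms(2)] by metis
  note h = iso_hom[OF assms(1)] iso_hom[OF assms(2)] iso_hom[OF *(1)] iso_hom[OF *(4)]
  have o: "A \<in> Ob K" "B \<in> Ob K" "A' \<in> Ob K" "B' \<in> Ob K"
    using h hom_Ob by blast+
  show ?thesis
    unfolding iso_def
    using prod_map_hom[OF h(1,2)] prod_map_hom[OF h(3,4)] prod_map_Cmp[OF h(1,3,2,4)] prod_map_Cmp[OF h(3,1,4,2)] o
    by (intro CollectI conjI bexI[of _ "prod_map K S f' g'"]) (simp_all add: * prod_map_Idt)
qed

lemma is_functor_prod_left: "A \<in> Ob K \<Longrightarrow> is_functor K K (prod_left K S A)"
  by unfold_locales
    (auto simp: prod_left_def prod_map_Idt prod_map_Cmp[OF Idt_hom Idt_hom] intro: prod_map_hom[OF Idt_hom])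

lemma is_functor_prod_right: "A \<in> Ob K \<Longrightarrow> is_functor K K (prod_right K S A)"
  by unfold_locales
    (auto simp: prod_right_def prod_map_Idt prod_map_Cmp[OF _ _ Idt_hom Idt_hom] intro: prod_map_hom[OF _ Idt_hom])

text \<open>Needed twice: exponentials are adjoint to \<open>prod_right\<close> whereas \<gamma>
  ends in \<open>prod_left\<close>, and \<open>ten_right\<close> has its factors in the other order.
  The isomorphism is the swap of factors, which is checked on the two projections.\<close>

lemma prod_left_iso_right:
  assumes A: "A \<in> Ob K"
  shows "naturally_isomorphic K K (prod_left K S A) (prod_right K S A)"
proof -
  define \<sigma> where "\<sigma> A B = pairing K S (Proj2 S A B) (Proj1 S A B)" for A B
  have \<sigma>: "\<sigma> A B \<in> hom K (Prod S A B) (Prod S B A)"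
      "Proj1 S B A \<cdot>\<^bsub>K\<^esub> \<sigma> A B = Proj2 S A B" "Proj2 S B A \<cdot>\<^bsub>K\<^esub> \<sigma> A B = Proj1 S A B"
    if "A \<in> Ob K" "B \<in> Ob K" for A B
    unfolding \<sigma>_def using that by (auto intro!: pairing Proj1_hom Proj2_hom)
  have inv: "\<sigma> B A \<cdot>\<^bsub>K\<^esub> \<sigma> A B = Idt K (Prod S A B)" if AB: "A \<in> Ob K" "B \<in> Ob K" for A B
  proof (rule prod_eqI)
    note c = \<sigma>[OF AB] \<sigma>[OF AB(2,1)]
    show "Proj1 S A B \<cdot>\<^bsub>K\<^esub> (\<sigma> B A \<cdot>\<^bsub>K\<^esub> \<sigma> A B) = Proj1 S A B \<cdot>\<^bsub>K\<^esub> Idt K (Prod S A B)"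
      using Cmp_assoc[OF c(1,4) Proj1_hom[OF AB]] c AB by simp
    show "Proj2 S A B \<cdot>\<^bsub>K\<^esub> (\<sigma> B A \<cdot>\<^bsub>K\<^esub> \<sigma> A B) = Proj2 S A B \<cdot>\<^bsub>K\<^esub> Idt K (Prod S A B)"
      using Cmp_assoc[OF c(1,4) Proj2_hom[OF AB]] c AB by simp
    show "\<sigma> B A \<cdot>\<^bsub>K\<^esub> \<sigma> A B \<in> hom K (Prod S A B) (Prod S A B)"
      by (rule Cmp_hom[OF c(1,4)])
  qed (use AB in \<open>simp_all add: Idt_hom\<close>)
  interpret L: is_functor K K "prod_left K S A" by (rule is_functor_prod_left[OF A])
  interpret R: is_functor K K "prod_right K S A" by (rule is_functor_prod_right[OF A])
  have "nat_iso K K (prod_left K S A) (prod_right K S A) (\<sigma> A)"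
  proof unfold_locales
    fix f X Y assume f: "f \<in> hom K X Y"
    have XY: "X \<in> Ob K" "Y \<in> Ob K" using hom_Ob[OF f] by auto
    note i = Idt_hom[OF A]
    have "prod_map K S f (Idt K A) \<cdot>\<^bsub>K\<^esub> \<sigma> A X = pairing K S (f \<cdot>\<^bsub>K\<^esub> Proj2 S A X) (Idt K A \<cdot>\<^bsub>K\<^esub> Proj1 S A X)"
      unfolding \<sigma>_def by (rule prod_map_pairing[OF f i Proj2_hom[OF A XY(1)] Proj1_hom[OF A XY(1)]])
    also have "\<dots> = \<sigma> A Y \<cdot>\<^bsub>K\<^esub> prod_map K S (Idt K A) f"
      unfolding \<sigma>_def
      using pairing_Cmp[OF Proj2_hom Proj1_hom prod_map_hom[OF i f], OF A XY(2) A XY(2)]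
      by (simp add: prod_map[OF i f])
    finally show "\<sigma> A Y \<cdot>\<^bsub>K\<^esub> ar (prod_left K S A) f = ar (prod_right K S A) f \<cdot>\<^bsub>K\<^esub> \<sigma> A X"
      by (simp add: prod_left_def prod_right_def)
  next
    show "\<sigma> A X \<in> hom K (ob (prod_left K S A) X) (ob (prod_right K S A) X)"
      "\<sigma> A X \<in> iso K (ob (prod_left K S A) X) (ob (prod_right K S A) X)" if "X \<in> Ob K" for X
      using \<sigma>[OF A that] \<sigma>[OF that A] inv[OF A that] inv[OF that A]
      by (auto simp: prod_left_def prod_right_def iso_def)
  qed
  then show ?thesis
    by (auto simp: naturally_isomorphic_def)
qed

section \<open>Exponentials as right adjoints of products\<close>

lemma curry_bij:
  assumes "A \<in> Ob K" "B \<in> Ob K" "T \<in> Ob K"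
  shows "bij_betw (\<lambda>h. Ev S A B \<cdot>\<^bsub>K\<^esub> prod_map K S h (Idt K A)) (hom K T (Exp S A B)) (hom K (Prod S T A) B)"
proof (rule bij_betw_imageI)
  have ev: "Ev S A B \<cdot>\<^bsub>K\<^esub> prod_map K S h (Idt K A) \<in> hom K (Prod S T A) B" if "h \<in> hom K T (Exp S A B)" for h
    using Cmp_hom[OF prod_map_hom[OF that Idt_hom] Ev_hom] assms by auto
  then show "inj_on (\<lambda>h. Ev S A B \<cdot>\<^bsub>K\<^esub> prod_map K S h (Idt K A)) (hom K T (Exp S A B))"
    using Exp_universal[OF assms] by (intro inj_onI) metis
  show "(\<lambda>h. Ev S A B \<cdot>\<^bsub>K\<^esub> prod_map K S h (Idt K A)) ` hom K T (Exp S A B) = hom K (Prod S T A) B"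
    using ev Exp_universal[OF assms] by (auto simp: image_iff) metis
qed

lemma ar_exp_func:
  assumes A: "A \<in> Ob K" and g: "g \<in> hom K B B'"
  shows ar_exp_func_hom: "ar (exp_func K S A) g \<in> hom K (Exp S A B) (Exp S A B')"
    and Ev_exp_func: "Ev S A B' \<cdot>\<^bsub>K\<^esub> prod_map K S (ar (exp_func K S A) g) (Idt K A) = g \<cdot>\<^bsub>K\<^esub> Ev S A B"
proof -
  have o: "B \<in> Ob K" "B' \<in> Ob K"
    using hom_Ob[OF g] by auto
  have "g \<cdot>\<^bsub>K\<^esub> Ev S A B \<in> hom K (Prod S (Exp S A B) A) B'"
    using Cmp_hom[OF Ev_hom[OF A o(1)] g] .
  from theI'[OF Exp_universal[OF A o(2) Exp_Ob[OF A o(1)] this]] g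
  show "ar (exp_func K S A) g \<in> hom K (Exp S A B) (Exp S A B')"
    "Ev S A B' \<cdot>\<^bsub>K\<^esub> prod_map K S (ar (exp_func K S A) g) (Idt K A) = g \<cdot>\<^bsub>K\<^esub> Ev S A B"
    by (simp_all add: exp_func_def hom_def)
qed

text \<open>Naturality of uncurrying in both variables, arranged in the shape that
  \<open>hom_iso\<close> asks for. The product map splits along composition, and the equation
  characterizing \<open>exp_func\<close> on arrows moves \<open>g\<close> past evaluation.\<close>

lemma Ev_natural:
  assumes A: "A \<in> Ob K" and f: "f \<in> hom K T' T" and h: "h \<in> hom K T (Exp S A B)" and g: "g \<in> hom K B B'"
  shows "Ev S A B' \<cdot>\<^bsub>K\<^esub> prod_map K S (ar (exp_func K S A) g \<cdot>\<^bsub>K\<^esub> (h \<cdot>\<^bsub>K\<^esub> f)) (Idt K A) =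
    g \<cdot>\<^bsub>K\<^esub> ((Ev S A B \<cdot>\<^bsub>K\<^esub> prod_map K S h (Idt K A)) \<cdot>\<^bsub>K\<^esub> prod_map K S f (Idt K A))"
proof -
  have o: "B \<in> Ob K" "B' \<in> Ob K"
    using hom_Ob[OF g] by auto
  note i = Idt_hom[OF A]
  note hf = Cmp_hom[OF f h] and e = ar_exp_func_hom[OF A g]
  note pe = prod_map_hom[OF e i] and ph = prod_map_hom[OF h i] and pf = prod_map_hom[OF f i]
  have "prod_map K S (ar (exp_func K S A) g \<cdot>\<^bsub>K\<^esub> (h \<cdot>\<^bsub>K\<^esub> f)) (Idt K A) =
      prod_map K S (ar (exp_func K S A) g) (Idt K A) \<cdot>\<^bsub>K\<^esub> (prod_map K S h (Idt K A) \<cdot>\<^bsub>K\<^esub> prod_map K S f (Idt K A))"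
    using prod_map_Cmp[OF hf e i i] prod_map_Cmp[OF f h i i] A by simp
  then show ?thesis
    using arg_cong[OF Ev_exp_func[OF A g], of "\<lambda>k. k \<cdot>\<^bsub>K\<^esub> (prod_map K S h (Idt K A) \<cdot>\<^bsub>K\<^esub> prod_map K S f (Idt K A))"]
      pe ph pf Ev_hom[OF A o(1)] Ev_hom[OF A o(2)] g
    by (simp add: hom_def)
qed

lemma is_functor_exp_func:
  assumes A: "A \<in> Ob K"
  shows "is_functor K K (exp_func K S A)"
proof unfold_locales
  \<comment> \<open>Uncurrying is injective, so the functor laws can be verified after
    evaluation.\<close>
  have eqI: "h = h'" if "h \<in> hom K T (Exp S A B)" "h' \<in> hom K T (Exp S A B)" "B \<in> Ob K"
    "Ev S A B \<cdot>\<^bsub>K\<^esub> prod_map K S h (Idt K A) = Ev S A B \<cdot>\<^bsub>K\<^esub> prod_map K S h' (Idt K A)" for h h' T B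
    using inj_onD[OF bij_betw_imp_inj_on[OF curry_bij] that(4)] A that hom_Ob by blast
  note e = ar_exp_func[OF A] and i = Idt_hom[OF A]
  show "ob (exp_func K S A) X \<in> Ob K" if "X \<in> Ob K" for X
    using A that by (simp add: exp_func_def)
  show "ar (exp_func K S A) f \<in> hom K (ob (exp_func K S A) X) (ob (exp_func K S A) Y)"
    if "f \<in> hom K X Y" for f X Y
    using e(1)[OF that] by (simp add: exp_func_def)
  show "ar (exp_func K S A) (Idt K X) = Idt K (ob (exp_func K S A) X)" if X: "X \<in> Ob K" for X
    by (rule eqI[of _ "Exp S A X" X])
      (use e[OF Idt_hom[OF X]] X A Ev_hom[OF A X] in \<open>simp_all add: exp_func_def prod_map_Idt hom_def\<close>)
  show "ar (exp_func K S A) (g \<cdot>\<^bsub>K\<^esub> f) = ar (exp_func K S A) g \<cdot>\<^bsub>K\<^esub> ar (exp_func K S A) f"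
    if f: "f \<in> hom K X Y" and g: "g \<in> hom K Y Z" for f g X Y Z
  proof (rule eqI)
    have XYZ: "X \<in> Ob K" "Y \<in> Ob K" "Z \<in> Ob K"
      using hom_Ob f g by blast+
    note gf = Cmp_hom[OF f g] and ef = ar_exp_func_hom[OF A f] and eg = ar_exp_func_hom[OF A g]
    show "ar (exp_func K S A) (g \<cdot>\<^bsub>K\<^esub> f) \<in> hom K (Exp S A X) (Exp S A Z)"
      "ar (exp_func K S A) g \<cdot>\<^bsub>K\<^esub> ar (exp_func K S A) f \<in> hom K (Exp S A X) (Exp S A Z)" "Z \<in> Ob K"
      using e(1)[OF gf] Cmp_hom[OF ef eg] XYZ by auto
    \<comment> \<open>This is \<open>Ev_natural\<close> with an identity arrow in the first variable
      and \<open>ar (exp_func K S A) f\<close> as the arrow being uncurried.\<close>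
    have "Ev S A Z \<cdot>\<^bsub>K\<^esub> prod_map K S (ar (exp_func K S A) g \<cdot>\<^bsub>K\<^esub> (ar (exp_func K S A) f \<cdot>\<^bsub>K\<^esub> Idt K (Exp S A X))) (Idt K A) =
        g \<cdot>\<^bsub>K\<^esub> ((Ev S A Y \<cdot>\<^bsub>K\<^esub> prod_map K S (ar (exp_func K S A) f) (Idt K A)) \<cdot>\<^bsub>K\<^esub> prod_map K S (Idt K (Exp S A X)) (Idt K A))"
      by (rule Ev_natural[OF A Idt_hom[OF Exp_Ob[OF A XYZ(1)]] ef g])
    also have "\<dots> = (g \<cdot>\<^bsub>K\<^esub> f) \<cdot>\<^bsub>K\<^esub> Ev S A X"
      using XYZ A f g Ev_hom[OF A XYZ(1)] by (simp add: e(2)[OF f] prod_map_Idt hom_def)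
    finally show "Ev S A Z \<cdot>\<^bsub>K\<^esub> prod_map K S (ar (exp_func K S A) (g \<cdot>\<^bsub>K\<^esub> f)) (Idt K A) =
        Ev S A Z \<cdot>\<^bsub>K\<^esub> prod_map K S (ar (exp_func K S A) g \<cdot>\<^bsub>K\<^esub> ar (exp_func K S A) f) (Idt K A)"
      using e(2)[OF gf] ef by (simp add: hom_def)
  qed
qed

lemma hom_iso_exp:
  assumes A: "A \<in> Ob K" and F: "is_functor A' K F" and H: "is_functor E K H"
  shows "hom_iso A' E K (prod_right K S A \<odot> F) H K F (exp_func K S A \<odot> H)"
proof (rule hom_iso_sym)
  interpret F: is_functor A' K F by fact
  interpret H: is_functor E K H by fact
  \<comment> \<open>The reversed bijection is treated because uncurrying has an explicit formula
    through \<open>Ev\<close>.\<close>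
  show "hom_iso A' E K F (exp_func K S A \<odot> H) K (prod_right K S A \<odot> F) H"
  proof (rule hom_isoI[OF F is_functor_comp[OF H is_functor_exp_func[OF A]]
        is_functor_comp[OF F is_functor_prod_right[OF A]] H,
        where \<phi> = "\<lambda>a e h. Ev S A (ob H e) \<cdot>\<^bsub>K\<^esub> prod_map K S h (Idt K A)"])
    fix a e assume "a \<in> Ob A'" "e \<in> Ob E"
    then show "bij_betw (\<lambda>h. Ev S A (ob H e) \<cdot>\<^bsub>K\<^esub> prod_map K S h (Idt K A))
        (hom K (ob F a) (ob (exp_func K S A \<odot> H) e)) (hom K (ob (prod_right K S A \<odot> F) a) (ob H e))"
      using curry_bij[OF A, of "ob H e" "ob F a"] by (simp add: exp_func_def prod_right_def)
  next
    fix a a' e e' f g h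
    assume "f \<in> hom A' a' a" "g \<in> hom E e e'" "h \<in> hom K (ob F a) (ob (exp_func K S A \<odot> H) e)"
    then show "Ev S A (ob H e') \<cdot>\<^bsub>K\<^esub> prod_map K S (ar (exp_func K S A \<odot> H) g \<cdot>\<^bsub>K\<^esub> (h \<cdot>\<^bsub>K\<^esub> ar F f)) (Idt K A) =
        ar H g \<cdot>\<^bsub>K\<^esub> ((Ev S A (ob H e) \<cdot>\<^bsub>K\<^esub> prod_map K S h (Idt K A)) \<cdot>\<^bsub>K\<^esub> ar (prod_right K S A \<odot> F) f)"
      using Ev_natural[OF A F.ar_hom _ H.ar_hom, of f a' a h e g e'] by (simp add: exp_func_def prod_right_def)
  qed
qed

end

section \<open>Yoneda lemma and equivalences\<close>

text \<open>Naturality in the first variable makes \<open>\<phi>\<close> postcomposition with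
  \<open>\<theta> e\<close>, the image of an identity. These postcompositions are bijective for
  every test object: surjectivity at \<open>ob H' e\<close> gives a right inverse of
  \<open>\<theta> e\<close>, and injectivity at \<open>ob H e\<close> makes it a left
  inverse.\<close>

lemma yoneda_right:
  assumes "hom_iso A E A id_func H A id_func H'"
  shows "naturally_isomorphic E A H H'"
proof -
  obtain \<phi> where "is_functor A A id_func" "is_functor E A H"
      "is_functor A A id_func" "is_functor E A H'"
    and bij: "\<And>a e. \<lbrakk>a \<in> Ob A; e \<in> Ob E\<rbrakk> \<Longrightarrow>
      bij_betw (\<phi> a e) (hom A a (ob H e)) (hom A a (ob H' e))"
    and nat: "\<And>a a' e e' f g h. \<lbrakk>f \<in> hom A a' a; g \<in> hom E e e'; h \<in> hom A a (ob H e)\<rbrakk> \<Longrightarrow>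
      \<phi> a' e' (ar H g \<cdot>\<^bsub>A\<^esub> (h \<cdot>\<^bsub>A\<^esub> f)) = ar H' g \<cdot>\<^bsub>A\<^esub> (\<phi> a e h \<cdot>\<^bsub>A\<^esub> f)"
    by (rule hom_isoE[OF assms, unfolded ob_id_func ar_id_func]) (rule that)
  then interpret H: is_functor E A H + H': is_functor E A H' by auto
  define \<theta> where "\<theta> e = \<phi> (ob H e) e (Idt A (ob H e))" for e
  have \<theta>: "\<theta> e \<in> hom A (ob H e) (ob H' e)" if "e \<in> Ob E" for e
    unfolding \<theta>_def using bij[of "ob H e" e] that by (auto dest!: bij_betwE simp: hom_def)
  have \<phi>: "\<phi> a e h = \<theta> e \<cdot>\<^bsub>A\<^esub> h" if "h \<in> hom A a (ob H e)" "e \<in> Ob E" for a e h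
    using nat[OF that(1) H.A.Idt_hom[OF that(2)], of "Idt A (ob H e)"] that \<theta>[OF that(2)]
    by (simp add: hom_def \<theta>_def)
  have bij\<theta>: "bij_betw (\<lambda>h. \<theta> e \<cdot>\<^bsub>A\<^esub> h) (hom A a (ob H e)) (hom A a (ob H' e))"
    if "a \<in> Ob A" "e \<in> Ob E" for a e
    using bij[OF that] \<phi> that by (simp cong: bij_betw_cong)
  have iso: "\<theta> e \<in> iso A (ob H e) (ob H' e)" if e: "e \<in> Ob E" for e
  proof -
    obtain u where u: "u \<in> hom A (ob H' e) (ob H e)" "\<theta> e \<cdot>\<^bsub>A\<^esub> u = Idt A (ob H' e)"
      using bij_betw_imp_surj_on[OF bij\<theta>, of "ob H' e" e] e H.B.Idt_hom[of "ob H' e"] by force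
    have "\<theta> e \<cdot>\<^bsub>A\<^esub> (u \<cdot>\<^bsub>A\<^esub> \<theta> e) = \<theta> e \<cdot>\<^bsub>A\<^esub> Idt A (ob H e)"
      using H.B.Cmp_inverse_left[OF u(2) u(1) \<theta>[OF e], of "\<theta> e"] \<theta>[OF e] e by (simp add: hom_def)
    from inj_onD[OF bij_betw_imp_inj_on[OF bij\<theta>[OF H.ob_Ob[OF e] e]] this
        H.B.Cmp_hom[OF \<theta>[OF e] u(1)] H.B.Idt_hom[OF H.ob_Ob[OF e]]]
    have "u \<cdot>\<^bsub>A\<^esub> \<theta> e = Idt A (ob H e)" .
    then show ?thesis
      using \<theta>[OF e] u by (auto simp: iso_def)
  qed
  have "nat_iso E A H H' \<theta>"
  proof (unfold_locales; (rule \<theta> iso; assumption)?)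
    fix f X Y assume f: "f \<in> hom E X Y"
    note XY = H.A.hom_Ob[OF f]
    \<comment> \<open>Both sides are the value of \<open>\<phi>\<close> at \<open>ar H f\<close>:
      the left one because \<open>\<phi>\<close> is postcomposition, the right one by naturality in
      the second variable.\<close>
    show "\<theta> Y \<cdot>\<^bsub>A\<^esub> ar H f = ar H' f \<cdot>\<^bsub>A\<^esub> \<theta> X"
      using nat[OF H.B.Idt_hom f, of "ob H X" "Idt A (ob H X)"] \<phi>[OF H.ar_hom[OF f]] XY f \<theta>[of X]
      by (simp add: hom_def \<theta>_def)
  qed
  then show ?thesis
    by (auto simp: naturally_isomorphic_def)
qed

text \<open>The dual argument. An identity of \<open>ob F a\<close> is now sent to an arrow out of
  \<open>ob F' a\<close>, so the isomorphism found points from \<open>F'\<close> to \<open>F\<close>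
  and is reversed at the end.\<close>

lemma yoneda_left:
  assumes "hom_iso A E E F id_func E F' id_func"
  shows "naturally_isomorphic A E F F'"
proof -
  obtain \<phi> where "is_functor A E F" "is_functor E E id_func"
      "is_functor A E F'" "is_functor E E id_func"
    and bij: "\<And>a e. \<lbrakk>a \<in> Ob A; e \<in> Ob E\<rbrakk> \<Longrightarrow>
      bij_betw (\<phi> a e) (hom E (ob F a) e) (hom E (ob F' a) e)"
    and nat: "\<And>a a' e e' f g h. \<lbrakk>f \<in> hom A a' a; g \<in> hom E e e'; h \<in> hom E (ob F a) e\<rbrakk> \<Longrightarrow>
      \<phi> a' e' (g \<cdot>\<^bsub>E\<^esub> (h \<cdot>\<^bsub>E\<^esub> ar F f)) = g \<cdot>\<^bsub>E\<^esub> (\<phi> a e h \<cdot>\<^bsub>E\<^esub> ar F' f)"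
    by (rule hom_isoE[OF assms, unfolded ob_id_func ar_id_func]) (rule that)
  then interpret F: is_functor A E F + F': is_functor A E F' by auto
  define \<theta> where "\<theta> a = \<phi> a (ob F a) (Idt E (ob F a))" for a
  have \<theta>: "\<theta> a \<in> hom E (ob F' a) (ob F a)" if "a \<in> Ob A" for a
    unfolding \<theta>_def using bij[of a "ob F a"] that by (auto dest!: bij_betwE simp: hom_def)
  have \<phi>: "\<phi> a e h = h \<cdot>\<^bsub>E\<^esub> \<theta> a" if "h \<in> hom E (ob F a) e" "a \<in> Ob A" for a e h
    using nat[OF F.A.Idt_hom[OF that(2)] that(1), of "Idt E (ob F a)"] that \<theta>[OF that(2)]
    by (simp add: hom_def \<theta>_def)
  have bij\<theta>: "bij_betw (\<lambda>h. h \<cdot>\<^bsub>E\<^esub> \<theta> a) (hom E (ob F a) e) (hom E (ob F' a) e)"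
    if "a \<in> Ob A" "e \<in> Ob E" for a e
    using bij[OF that] \<phi> that by (simp cong: bij_betw_cong)
  have iso: "\<theta> a \<in> iso E (ob F' a) (ob F a)" if a: "a \<in> Ob A" for a
  proof -
    obtain u where u: "u \<in> hom E (ob F a) (ob F' a)" "u \<cdot>\<^bsub>E\<^esub> \<theta> a = Idt E (ob F' a)"
      using bij_betw_imp_surj_on[OF bij\<theta>, of a "ob F' a"] a F.B.Idt_hom[of "ob F' a"] by force
    have "(\<theta> a \<cdot>\<^bsub>E\<^esub> u) \<cdot>\<^bsub>E\<^esub> \<theta> a = Idt E (ob F a) \<cdot>\<^bsub>E\<^esub> \<theta> a"
      using u \<theta>[OF a] a by (simp add: hom_def)
    from inj_onD[OF bij_betw_imp_inj_on[OF bij\<theta>[OF a F.ob_Ob[OF a]]] this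
        F.B.Cmp_hom[OF u(1) \<theta>[OF a]] F.B.Idt_hom[OF F.ob_Ob[OF a]]]
    have "\<theta> a \<cdot>\<^bsub>E\<^esub> u = Idt E (ob F a)" .
    then show ?thesis
      using \<theta>[OF a] u by (auto simp: iso_def)
  qed
  have "nat_iso A E F' F \<theta>"
  proof (unfold_locales; (rule \<theta> iso; assumption)?)
    fix f X Y assume f: "f \<in> hom A X Y"
    note XY = F.A.hom_Ob[OF f]
    show "\<theta> Y \<cdot>\<^bsub>E\<^esub> ar F' f = ar F f \<cdot>\<^bsub>E\<^esub> \<theta> X"
      using nat[OF f F.B.Idt_hom, of "ob F Y" "Idt E (ob F Y)"] \<phi>[OF F.ar_hom[OF f]] XY f \<theta>[of Y]
      by (simp add: hom_def \<theta>_def)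
  qed
  then have "naturally_isomorphic A E F' F"
    by (auto simp: naturally_isomorphic_def)
  then show ?thesis
    by (rule naturally_isomorphic_sym)
qed

section \<open>Equivalences of categories\<close>

lemma quasi_inverse_sym: "quasi_inverse A B F G \<Longrightarrow> quasi_inverse B A G F"
  by (simp add: quasi_inverse_def)

lemma quasi_inverse_inj:
  assumes "quasi_inverse A B F G" "f \<in> hom A X Y" "g \<in> hom A X Y" "ar F f = ar F g"
  shows "f = g"
proof -
  interpret F: is_functor A B F using assms by (simp add: quasi_inverse_def)
  interpret G: is_functor B A G using assms by (simp add: quasi_inverse_def)
  obtain \<theta> where "nat_iso A A (G \<odot> F) id_func \<theta>"
    using assms by (auto simp: quasi_inverse_def naturally_isomorphic_def)
  then interpret \<theta>: nat_iso A A "G \<odot> F" id_func \<theta> .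
  have XY: "X \<in> Ob A" "Y \<in> Ob A"
    using F.A.hom_Ob[OF assms(2)] by auto
  obtain u where u: "u \<in> iso A X (ob G (ob F X))" "\<theta> X \<cdot>\<^bsub>A\<^esub> u = Idt A X"
    using iso_inverseE[OF \<theta>.component_iso[OF XY(1)]] by auto
  \<comment> \<open>Conjugation by the natural isomorphism \<open>\<theta>\<close> recovers
    \<open>k\<close> from \<open>ar G (ar F k)\<close>, which depends only on
    \<open>ar F k\<close>.\<close>
  have *: "k = \<theta> Y \<cdot>\<^bsub>A\<^esub> ar G (ar F k) \<cdot>\<^bsub>A\<^esub> u" if k: "k \<in> hom A X Y" for k
  proof -
    have "k = (k \<cdot>\<^bsub>A\<^esub> \<theta> X) \<cdot>\<^bsub>A\<^esub> u"
      using \<theta>.component[OF XY(1)] u(2) k iso_hom[OF u(1)] by (simp add: hom_def)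
    then show ?thesis
      using \<theta>.naturality[OF k] by simp
  qed
  show ?thesis
    by (rule trans[OF *[OF assms(2)] trans[OF _ *[OF assms(3), symmetric]]]) (simp add: assms(4))
qed

text \<open>For fullness, the candidate preimage \<open>f\<close> of \<open>h\<close> is
  \<open>ar G h\<close> conjugated by \<open>\<theta>\<close>. Then \<open>ar G\<close> agrees on
  \<open>ar F f\<close> and \<open>h\<close>, and \<open>G\<close>, being half of an equivalence as
  well, is faithful.\<close>

lemma quasi_inverse_fully_faithful:
  assumes q: "quasi_inverse A B F G"
  shows "fully_faithful A B F"
  unfolding fully_faithful_def
proof (intro ballI)
  fix X Y assume XY: "X \<in> Ob A" "Y \<in> Ob A"
  interpret F: is_functor A B F using q by (simp add: quasi_inverse_def)
  interpret G: is_functor B A G using q by (simp add: quasi_inverse_def)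
  obtain \<theta> where "nat_iso A A (G \<odot> F) id_func \<theta>"
    using q by (auto simp: quasi_inverse_def naturally_isomorphic_def)
  then interpret \<theta>: nat_iso A A "G \<odot> F" id_func \<theta> .
  obtain u where u: "u \<in> iso A X (ob G (ob F X))" "u \<cdot>\<^bsub>A\<^esub> \<theta> X = Idt A (ob G (ob F X))"
    using iso_inverseE[OF \<theta>.component_iso[OF XY(1)]] by auto
  obtain v where v: "v \<in> iso A Y (ob G (ob F Y))" "v \<cdot>\<^bsub>A\<^esub> \<theta> Y = Idt A (ob G (ob F Y))"
    using iso_inverseE[OF \<theta>.component_iso[OF XY(2)]] by auto
  note c = \<theta>.component[OF XY(1)] \<theta>.component[OF XY(2)] iso_hom[OF u(1)] iso_hom[OF v(1)]
  have "\<exists>f \<in> hom A X Y. ar F f = h" if h: "h \<in> hom B (ob F X) (ob F Y)" for h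
  proof -
    define f where "f = \<theta> Y \<cdot>\<^bsub>A\<^esub> (ar G h \<cdot>\<^bsub>A\<^esub> u)"
    have f: "f \<in> hom A X Y"
      unfolding f_def using c h by (simp add: hom_def)
    have inv: "v \<cdot>\<^bsub>A\<^esub> (\<theta> Y \<cdot>\<^bsub>A\<^esub> k) = k" if "k \<in> Ar A" "Cod A k = ob G (ob F Y)" for k
      using F.A.Cmp_inverse_left[OF v(2) _ c(4) that] c(2) by simp
    have "\<theta> Y \<cdot>\<^bsub>A\<^esub> ar G (ar F f) = f \<cdot>\<^bsub>A\<^esub> \<theta> X"
      using \<theta>.naturality[OF f] by simp
    also have "\<dots> = \<theta> Y \<cdot>\<^bsub>A\<^esub> ar G h"
      unfolding f_def using c h u(2) by (simp add: hom_def)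
    finally have eq: "\<theta> Y \<cdot>\<^bsub>A\<^esub> ar G (ar F f) = \<theta> Y \<cdot>\<^bsub>A\<^esub> ar G h" .
    have "ar G (ar F f) = v \<cdot>\<^bsub>A\<^esub> (\<theta> Y \<cdot>\<^bsub>A\<^esub> ar G (ar F f))"
      using f by (intro inv[symmetric]) (simp_all add: hom_def)
    also have "\<dots> = ar G h"
      unfolding eq using h by (intro inv) (simp_all add: hom_def)
    finally have "ar G (ar F f) = ar G h" .
    then have "ar F f = h"
      using quasi_inverse_inj[OF quasi_inverse_sym[OF q] F.ar_hom[OF f] h] by simp
    then show ?thesis
      using f by blast
  qed
  moreover have "inj_on (ar F) (hom A X Y)"
    using quasi_inverse_inj[OF q] by (auto intro: inj_onI)
  ultimately show "bij_betw (ar F) (hom A X Y) (hom B (ob F X) (ob F Y))"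
    using F.ar_hom unfolding bij_betw_def by blast
qed

section \<open>Adjunctions with a Frobenius law\<close>

text \<open>Transposition along the adjunction turns precomposition with \<open>u\<close> into
  precomposition with \<open>ar F u\<close>, which is bijective as soon as \<open>ar F u\<close> is
  invertible. So objects in the image of a right adjoint are local for the arrows that the left
  adjoint inverts.\<close>

lemma precomp_bij_adjunction:
  assumes adj: "adjunction A B F G \<eta> \<epsilon>"
    and u: "u \<in> hom A X Y" "ar F u \<in> iso B (ob F X) (ob F Y)" and Z: "Z \<in> Ob B"
  shows "precomp_bij A X Y (ob G Z) u"
proof -
  interpret F: is_functor A B F by (rule adjunction.left_functor[OF adj])
  interpret G: is_functor B A G by (rule adjunction.right_functor[OF adj])
  interpret adj: adjunction A B F G \<eta> \<epsilon> by fact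
  have h: "hom_iso A B B F id_func A id_func G"
    using hom_iso_adjunction[OF adj is_functor_id is_functor_id]
    by (simp add: F.A.category_axioms F.B.category_axioms)
  obtain \<phi> where "is_functor A B F" "is_functor B B id_func" "is_functor A A id_func" "is_functor B A G"
    and bij: "\<And>a e. \<lbrakk>a \<in> Ob A; e \<in> Ob B\<rbrakk> \<Longrightarrow>
      bij_betw (\<phi> a e) (hom B (ob F a) e) (hom A a (ob G e))"
    and nat: "\<And>a a' e e' f g h. \<lbrakk>f \<in> hom A a' a; g \<in> hom B e e'; h \<in> hom B (ob F a) e\<rbrakk> \<Longrightarrow>
      \<phi> a' e' (g \<cdot>\<^bsub>B\<^esub> (h \<cdot>\<^bsub>B\<^esub> ar F f)) = ar G g \<cdot>\<^bsub>A\<^esub> (\<phi> a e h \<cdot>\<^bsub>A\<^esub> f)"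
    by (rule hom_isoE[OF h, unfolded ob_id_func ar_id_func]) (rule that)
  have XY: "X \<in> Ob A" "Y \<in> Ob A"
    using F.A.hom_Ob[OF u(1)] by auto
  have Fu: "bij_betw (\<lambda>h. h \<cdot>\<^bsub>B\<^esub> ar F u) (hom B (ob F Y) Z) (hom B (ob F X) Z)"
    using F.B.precomp_bij_iso[OF u(2)] by (simp add: precomp_bij_def)
  have "(\<phi> X Z \<circ> (\<lambda>h. h \<cdot>\<^bsub>B\<^esub> ar F u)) h = ((\<lambda>h. h \<cdot>\<^bsub>A\<^esub> u) \<circ> \<phi> Y Z) h" if h: "h \<in> hom B (ob F Y) Z" for h
  proof -
    have "\<phi> Y Z h \<in> hom A Y (ob G Z)"
      using bij_betwE[OF bij[OF XY(2) Z]] h by blast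
    then show ?thesis
      using nat[OF u(1) F.B.Idt_hom[OF Z] h] u(1) h Z by (simp add: hom_def)
  qed
  then have "bij_betw ((\<lambda>h. h \<cdot>\<^bsub>A\<^esub> u) \<circ> \<phi> Y Z) (hom B (ob F Y) Z) (hom A X (ob G Z))"
    using bij_betw_trans[OF Fu bij[OF XY(1) Z]] by (simp cong: bij_betw_cong)
  then show ?thesis
    unfolding precomp_bij_def using u(1) bij_betw_comp_iff[OF bij[OF XY(2) Z]] by blast
qed

text \<open>This makes the inclusion of a terminal object of \<open>M 1\<close> or
  \<open>M' 1\<close> terminal in \<open>P 1\<close>; the slices are built from that object.\<close>

lemma right_adjoint_terminal:
  assumes adj: "adjunction A B F G \<eta> \<epsilon>" and t: "terminal B t"
  shows "terminal A (ob G t)"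
proof -
  interpret F: is_functor A B F by (rule adjunction.left_functor[OF adj])
  interpret G: is_functor B A G by (rule adjunction.right_functor[OF adj])
  interpret adj: adjunction A B F G \<eta> \<epsilon> by fact
  have o: "t \<in> Ob B" "ob G t \<in> Ob A"
    using t by (auto simp: terminal_def)
  show ?thesis
    unfolding terminal_def
  proof (intro conjI ballI ex_ex1I)
    fix X assume X: "X \<in> Ob A"
    then obtain h where h: "h \<in> hom B (ob F X) t"
      using t by (meson F.ob_Ob terminal_def)
    show "\<exists>f. f \<in> hom A X (ob G t)"
      using F.A.Cmp_hom[OF adj.unit.component[OF X]] G.ar_hom[OF h] by auto
    fix f g assume f: "f \<in> hom A X (ob G t)" and g: "g \<in> hom A X (ob G t)"
    \<comment> \<open>Every \<open>k\<close> is rebuilt from its transpose, and transposes are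
      arrows into the terminal object \<open>t\<close>.\<close>
    have e: "k = ar G (\<epsilon> t \<cdot>\<^bsub>B\<^esub> ar F k) \<cdot>\<^bsub>A\<^esub> \<eta> X" if k: "k \<in> hom A X (ob G t)" for k
    proof -
      note c = adj.unit.component[OF X] adj.unit.component[OF o(2)] adj.counit.component[OF o(1)]
      have "k = (ar G (\<epsilon> t) \<cdot>\<^bsub>A\<^esub> \<eta> (ob G t)) \<cdot>\<^bsub>A\<^esub> k"
        using adj.triangle_right[OF o(1)] k by (simp add: hom_def)
      also have "\<dots> = ar G (\<epsilon> t) \<cdot>\<^bsub>A\<^esub> (ar G (ar F k) \<cdot>\<^bsub>A\<^esub> \<eta> X)"
        using adj.unit.naturality[OF k] c k by (simp add: hom_def)
      also have "\<dots> = ar G (\<epsilon> t \<cdot>\<^bsub>B\<^esub> ar F k) \<cdot>\<^bsub>A\<^esub> \<eta> X"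
        using c k by (simp add: hom_def)
      finally show ?thesis .
    qed
    have "\<epsilon> t \<cdot>\<^bsub>B\<^esub> ar F k \<in> hom B (ob F X) t" if "k \<in> hom A X (ob G t)" for k
      using F.B.Cmp_hom[OF F.ar_hom[OF that]] adj.counit.component[OF o(1)] by simp
    then have "\<epsilon> t \<cdot>\<^bsub>B\<^esub> ar F f = \<epsilon> t \<cdot>\<^bsub>B\<^esub> ar F g"
      using F.B.terminal_eq[OF t] f g by blast
    then show "f = g"
      by (intro trans[OF e[OF f] trans[OF _ e[OF g, symmetric]]]) simp
  qed (rule o)
qed

lemma naturally_isomorphic_refl:
  assumes "is_functor A B F"
  shows "naturally_isomorphic A B F F"
proof -
  interpret is_functor A B F by fact
  have "nat_iso A B F F (\<lambda>X. Idt B (ob F X))"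
    by unfold_locales (auto simp: B.iso_Idt B.Idt_hom hom_def)
  then show ?thesis
    by (auto simp: naturally_isomorphic_def)
qed

text \<open>
  In the application \<open>Sig \<stileturn> Sb\<close> is \<open>\<Sigma>\<^sub>x \<stileturn> x\<^sup>*\<close> for a point \<open>x\<close> of \<open>X\<close> and \<open>Dia \<stileturn> I\<close>
  is \<open>\<diamond>\<^sub>X \<stileturn> i\<^sub>X\<close> or \<open>\<diamond>'\<^sub>X \<stileturn> i'\<^sub>X\<close>, so that \<open>Dia (Sig T)\<close> is the slice at \<open>x\<close>.
\<close>

locale frobenius_reflection =
  P: cartesian_closed P SP + Q: cartesian_closed Q SQ +
  Sig: adjunction P Q Sig Sb \<eta> \<epsilon> + Dia: adjunction Q M Dia I \<delta> \<delta>'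
  for P :: "('p, 'pa) cat" and SP and Q :: "('q, 'qa) cat" and SQ and Sig Sb \<eta> \<epsilon>
    and M :: "('m, 'ma) cat" and Dia I \<delta> \<delta>' +
  fixes T
  assumes T: "terminal P T"
    and frob: "R \<in> Ob Q \<Longrightarrow>
      pairing Q SQ (ar Sig (Proj1 SP T (ob Sb R))) (\<epsilon> R \<cdot>\<^bsub>Q\<^esub> ar Sig (Proj2 SP T (ob Sb R)))
        \<in> iso Q (ob Sig (Prod SP T (ob Sb R))) (Prod SQ (ob Sig T) R)"
begin

sublocale Sig_fun: is_functor P Q Sig by (rule Sig.left_functor)
sublocale Sb_fun: is_functor Q P Sb by (rule Sig.right_functor)
sublocale Dia_fun: is_functor Q M Dia by (rule Dia.left_functor)
sublocale I_fun: is_functor M Q I by (rule Dia.right_functor)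

section \<open>The comparison map \<gamma> and locality of objects for it\<close>

definition L where
  "L = ob I (ob Dia (ob Sig T))"

text \<open>The mixed Frobenius law for the single object \<open>ob Sig T\<close>, kept as a
  condition on \<open>N\<close>. In a temporal doctrine it holds when \<open>N\<close> lies in the
  image of the inclusion on the side opposite to \<open>I\<close>.\<close>

definition mixed :: "'q \<Rightarrow> bool" where
  "mixed N \<longleftrightarrow> ar Dia (prod_map Q SQ (\<delta> (ob Sig T)) (Idt Q N))
     \<in> iso M (ob Dia (Prod SQ (ob Sig T) N)) (ob Dia (Prod SQ L N))"

text \<open>Defining \<gamma> by its components, rather than through the Frobenius isomorphism,
  reduces its naturality to that of the counit and to uniqueness of arrows into \<open>T\<close>.
  The Frobenius law enters only in \<open>\<gamma>_factor\<close>.\<close>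

definition \<gamma> :: "'q \<Rightarrow> 'qa" where
  "\<gamma> R = pairing Q SQ (\<delta> (ob Sig T) \<cdot>\<^bsub>Q\<^esub> ar Sig (to_terminal P T (ob Sb R))) (\<epsilon> R)"

lemma T_Ob: "T \<in> Ob P"
  using T by (simp add: terminal_def)

lemma L_Ob: "L \<in> Ob Q"
  unfolding L_def using T_Ob by simp

lemma unit_hom: "\<delta> (ob Sig T) \<in> hom Q (ob Sig T) L"
  using Dia.unit.component[of "ob Sig T"] T_Ob by (simp add: L_def)

lemma counit_hom: "R \<in> Ob Q \<Longrightarrow> \<epsilon> R \<in> hom Q (ob Sig (ob Sb R)) R"
  using Sig.counit.component[of R] by simp

lemma Sig_to_terminal_hom:
  "R \<in> Ob Q \<Longrightarrow> ar Sig (to_terminal P T (ob Sb R)) \<in> hom Q (ob Sig (ob Sb R)) (ob Sig T)"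
  by (intro Sig_fun.ar_hom P.to_terminal_hom[OF T]) simp

lemma \<gamma>_natural: "nat_trans Q Q (Sig \<odot> Sb) (prod_left Q SQ L) \<gamma>"
proof -
  interpret F: is_functor Q Q "Sig \<odot> Sb" by (rule is_functor_comp; unfold_locales)
  interpret G: is_functor Q Q "prod_left Q SQ L" by (rule Q.is_functor_prod_left[OF L_Ob])
  show ?thesis
  proof unfold_locales
    show "\<gamma> R \<in> hom Q (ob (Sig \<odot> Sb) R) (ob (prod_left Q SQ L) R)" if "R \<in> Ob Q" for R
      using Q.pairing_hom[OF Q.Cmp_hom[OF Sig_to_terminal_hom[OF that] unit_hom] counit_hom[OF that]]
      by (simp add: \<gamma>_def prod_left_def)
  next
    fix g R R' assume g: "g \<in> hom Q R R'"
    have R: "R \<in> Ob Q" "R' \<in> Ob Q"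
      using Q.hom_Ob[OF g] by auto
    note u = Q.Cmp_hom[OF Sig_to_terminal_hom unit_hom]
    note Sg = Sig_fun.ar_hom[OF Sb_fun.ar_hom[OF g]]
    have "to_terminal P T (ob Sb R') \<cdot>\<^bsub>P\<^esub> ar Sb g = to_terminal P T (ob Sb R)"
      using R by (intro P.terminal_eq[OF T P.Cmp_hom[OF Sb_fun.ar_hom[OF g]]] P.to_terminal_hom[OF T]) auto
    then have *: "ar Sig (to_terminal P T (ob Sb R')) \<cdot>\<^bsub>Q\<^esub> ar Sig (ar Sb g) = ar Sig (to_terminal P T (ob Sb R))"
      using Sig_fun.ar_Cmp[OF Sb_fun.ar_hom[OF g] P.to_terminal_hom[OF T]] R by simp
    have "\<gamma> R' \<cdot>\<^bsub>Q\<^esub> ar Sig (ar Sb g) =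
        pairing Q SQ (\<delta> (ob Sig T) \<cdot>\<^bsub>Q\<^esub> ar Sig (to_terminal P T (ob Sb R))) (\<epsilon> R' \<cdot>\<^bsub>Q\<^esub> ar Sig (ar Sb g))"
      unfolding \<gamma>_def Q.pairing_Cmp[OF u[OF R(2)] counit_hom[OF R(2)] Sg]
      using Q.Cmp_assoc[OF Sg Sig_to_terminal_hom[OF R(2)] unit_hom] by (simp add: *)
    also have "\<epsilon> R' \<cdot>\<^bsub>Q\<^esub> ar Sig (ar Sb g) = g \<cdot>\<^bsub>Q\<^esub> \<epsilon> R"
      using Sig.counit.naturality[OF g] by simp
    also have "pairing Q SQ (\<delta> (ob Sig T) \<cdot>\<^bsub>Q\<^esub> ar Sig (to_terminal P T (ob Sb R))) (g \<cdot>\<^bsub>Q\<^esub> \<epsilon> R) =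
        prod_map Q SQ (Idt Q L) g \<cdot>\<^bsub>Q\<^esub> \<gamma> R"
      unfolding \<gamma>_def Q.prod_map_pairing[OF Q.Idt_hom[OF L_Ob] g u[OF R(1)] counit_hom[OF R(1)]]
        Q.Idt_left[OF u[OF R(1)]] ..
    finally show "\<gamma> R' \<cdot>\<^bsub>Q\<^esub> ar (Sig \<odot> Sb) g = ar (prod_left Q SQ L) g \<cdot>\<^bsub>Q\<^esub> \<gamma> R"
      by (simp add: prod_left_def)
  qed
qed

text \<open>As \<open>T\<close> is terminal, \<open>ob Sb R\<close> is isomorphic to its product
  with \<open>T\<close>. The arrow \<open>\<kappa>\<close> is \<open>Sig\<close> of this isomorphism
  followed by the Frobenius isomorphism. Its components are \<open>Sig\<close> of the arrow to
  \<open>T\<close> and the counit, so applying the unit to the first factor yields \<gamma>.\<close>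

lemma \<gamma>_factor:
  assumes R: "R \<in> Ob Q"
  obtains \<kappa> where "\<kappa> \<in> iso Q (ob Sig (ob Sb R)) (Prod SQ (ob Sig T) R)"
    "\<gamma> R = prod_map Q SQ (\<delta> (ob Sig T)) (Idt Q R) \<cdot>\<^bsub>Q\<^esub> \<kappa>"
proof -
  define R' where "R' = ob Sb R"
  have R': "R' \<in> Ob P" unfolding R'_def using R by simp
  note i = P.Idt_hom[OF R'] and tt = P.to_terminal_hom[OF T R']
  define d where "d = pairing P SP (to_terminal P T R') (Idt P R')"
  have d: "d \<in> hom P R' (Prod SP T R')" "Proj1 SP T R' \<cdot>\<^bsub>P\<^esub> d = to_terminal P T R'" "Proj2 SP T R' \<cdot>\<^bsub>P\<^esub> d = Idt P R'"
    unfolding d_def using P.pairing[OF tt i] by auto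
  note pr = P.Proj1_hom[OF T_Ob R'] P.Proj2_hom[OF T_Ob R']
  \<comment> \<open>Thus \<open>d\<close> is inverse to the second projection; the first components
    agree because they end in the terminal object \<open>T\<close>.\<close>
  have "d \<cdot>\<^bsub>P\<^esub> Proj2 SP T R' = Idt P (Prod SP T R')"
  proof (rule P.prod_eqI)
    show "Proj1 SP T R' \<cdot>\<^bsub>P\<^esub> (d \<cdot>\<^bsub>P\<^esub> Proj2 SP T R') = Proj1 SP T R' \<cdot>\<^bsub>P\<^esub> Idt P (Prod SP T R')"
      by (rule P.terminal_eq[OF T P.Cmp_hom[OF P.Cmp_hom[OF pr(2) d(1)] pr(1)] P.Cmp_hom[OF P.Idt_hom pr(1)]])
        (simp add: T_Ob R')
    show "Proj2 SP T R' \<cdot>\<^bsub>P\<^esub> (d \<cdot>\<^bsub>P\<^esub> Proj2 SP T R') = Proj2 SP T R' \<cdot>\<^bsub>P\<^esub> Idt P (Prod SP T R')"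
      using P.Cmp_assoc[OF pr(2) d(1) pr(2)] d(3) T_Ob R' by simp
  qed (use P.Cmp_hom[OF pr(2) d(1)] T_Ob R' in \<open>auto simp: P.Idt_hom\<close>)
  then have "d \<in> iso P R' (Prod SP T R')"
    using d pr(2) by (auto simp: iso_def)
  note d_iso = Sig_fun.ar_iso[OF this]
  let ?a = "ar Sig (Proj1 SP T R')" and ?b = "\<epsilon> R \<cdot>\<^bsub>Q\<^esub> ar Sig (Proj2 SP T R')"
  have e: "\<epsilon> R \<in> hom Q (ob Sig R') R"
    using counit_hom[OF R] by (simp add: R'_def)
  note Sp = Sig_fun.ar_hom[OF pr(1)] Sig_fun.ar_hom[OF pr(2)]
  note b = Q.Cmp_hom[OF Sp(2) e] and Sd = Sig_fun.ar_hom[OF d(1)]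
  have "?a \<cdot>\<^bsub>Q\<^esub> ar Sig d = ar Sig (to_terminal P T R')"
    using Sig_fun.ar_Cmp[OF d(1) pr(1)] d(2) by simp
  moreover have "?b \<cdot>\<^bsub>Q\<^esub> ar Sig d = \<epsilon> R"
    using Q.Cmp_assoc[OF Sd Sp(2) e, symmetric] Sig_fun.ar_Cmp[OF d(1) pr(2), symmetric] d(3) R' Q.Idt_right[OF e]
    by simp
  ultimately have \<kappa>: "pairing Q SQ ?a ?b \<cdot>\<^bsub>Q\<^esub> ar Sig d = pairing Q SQ (ar Sig (to_terminal P T R')) (\<epsilon> R)"
    using Q.pairing_Cmp[OF Sp(1) b Sd] by simp
  show thesis
  proof (rule that)
    show "pairing Q SQ ?a ?b \<cdot>\<^bsub>Q\<^esub> ar Sig d \<in> iso Q (ob Sig (ob Sb R)) (Prod SQ (ob Sig T) R)"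
      using Q.iso_Cmp[OF d_iso] frob[OF R] by (simp add: R'_def)
    show "\<gamma> R = prod_map Q SQ (\<delta> (ob Sig T)) (Idt Q R) \<cdot>\<^bsub>Q\<^esub> (pairing Q SQ ?a ?b \<cdot>\<^bsub>Q\<^esub> ar Sig d)"
      unfolding \<kappa> Q.prod_map_pairing[OF unit_hom Q.Idt_hom[OF R] Sig_fun.ar_hom[OF tt] e]
        Q.Idt_left[OF e] by (simp only: \<gamma>_def R'_def)
  qed
qed

text \<open>By the mixed law \<open>Dia\<close> inverts the unit times \<open>N\<close>, so every
  \<open>ob I Z\<close> is local for it, and locality passes to any \<open>R\<close> isomorphic to
  \<open>N\<close>. This extra freedom is needed because values of \<open>const_b\<close> are
  obtained in the images of the inclusions only up to isomorphism.\<close>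

lemma precomp_bij_unit:
  assumes N: "mixed N" "N \<in> Ob Q" and w: "w \<in> iso Q R N" and Z: "Z \<in> Ob M"
  shows "precomp_bij Q (Prod SQ (ob Sig T) R) (Prod SQ L R) (ob I Z) (prod_map Q SQ (\<delta> (ob Sig T)) (Idt Q R))"
proof -
  obtain v where v: "v \<in> iso Q N R" "v \<cdot>\<^bsub>Q\<^esub> w = Idt Q R"
    using iso_inverseE[OF w] by metis
  note hw = iso_hom[OF w] and hv = iso_hom[OF v(1)]
  have ST: "ob Sig T \<in> Ob Q"
    using T_Ob by simp
  note iT = Q.Idt_hom[OF ST] and iL = Q.Idt_hom[OF L_Ob] and iN = Q.Idt_hom[OF N(2)]
  have p: "precomp_bij Q (Prod SQ (ob Sig T) N) (Prod SQ L N) (ob I Z) (prod_map Q SQ (\<delta> (ob Sig T)) (Idt Q N))"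
    by (rule precomp_bij_adjunction[OF Dia.adjunction_axioms Q.prod_map_hom[OF unit_hom iN]])
      (use N(1) Z in \<open>simp_all add: mixed_def\<close>)
  \<comment> \<open>The unit times \<open>R\<close> is the unit times \<open>N\<close>, preceded by
    \<open>w\<close> and followed by its inverse \<open>v\<close> in the second factor.\<close>
  have "prod_map Q SQ (Idt Q L) v \<cdot>\<^bsub>Q\<^esub> (prod_map Q SQ (\<delta> (ob Sig T)) (Idt Q N) \<cdot>\<^bsub>Q\<^esub> prod_map Q SQ (Idt Q (ob Sig T)) w)
      = prod_map Q SQ (\<delta> (ob Sig T)) (Idt Q R)"
    unfolding Q.prod_map_Cmp[OF iT unit_hom hw iN] Q.Idt_left[OF hw] Q.Idt_right[OF unit_hom]
      Q.prod_map_Cmp[OF unit_hom iL hw hv] Q.Idt_left[OF unit_hom] v(2) ..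
  moreover have "precomp_bij Q (Prod SQ (ob Sig T) R) (Prod SQ L R) (ob I Z)
      (prod_map Q SQ (Idt Q L) v \<cdot>\<^bsub>Q\<^esub> (prod_map Q SQ (\<delta> (ob Sig T)) (Idt Q N) \<cdot>\<^bsub>Q\<^esub> prod_map Q SQ (Idt Q (ob Sig T)) w))"
    by (rule Q.precomp_bij_Cmp[OF Q.precomp_bij_Cmp[OF Q.precomp_bij_iso p] Q.precomp_bij_iso];
        intro Q.prod_map_iso Q.iso_Idt w v(1) L_Ob ST)
  ultimately show ?thesis
    by simp
qed

lemma precomp_bij_\<gamma>:
  assumes "mixed N" "N \<in> Ob Q" and w: "w \<in> iso Q R N" and "Z \<in> Ob M" and z: "z \<in> iso Q (ob I Z) Z'"
  shows "precomp_bij Q (ob Sig (ob Sb R)) (Prod SQ L R) Z' (\<gamma> R)"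
proof -
  have "R \<in> Ob Q"
    using Q.hom_Ob[OF iso_hom[OF w]] by simp
  then obtain \<kappa> where "\<kappa> \<in> iso Q (ob Sig (ob Sb R)) (Prod SQ (ob Sig T) R)"
      "\<gamma> R = prod_map Q SQ (\<delta> (ob Sig T)) (Idt Q R) \<cdot>\<^bsub>Q\<^esub> \<kappa>"
    by (rule \<gamma>_factor)
  then show ?thesis
    using Q.precomp_bij_target_iso[OF z Q.precomp_bij_Cmp[OF Q.precomp_bij_iso precomp_bij_unit]] assms
    by simp
qed

text \<open>Used in two ways: for \<open>nat_slice\<close>, \<open>F\<close> is the constant functor
  \<open>c\<close> and \<open>H\<close> is \<open>I\<close>; for \<open>ten_slice\<close>,
  \<open>F\<close> is an inclusion and \<open>H\<close> is \<open>c\<close>.\<close>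

lemma hom_iso_\<gamma>:
  assumes F: "is_functor A Q F" and H: "is_functor E Q H"
    and mixed: "\<And>a. a \<in> Ob A \<Longrightarrow> \<exists>N \<in> Ob Q. mixed N \<and> (\<exists>w. w \<in> iso Q (ob F a) N)"
    and reflective: "\<And>e. e \<in> Ob E \<Longrightarrow> \<exists>Z \<in> Ob M. \<exists>z. z \<in> iso Q (ob I Z) (ob H e)"
  shows "hom_iso A E Q (prod_left Q SQ L \<odot> F) H Q (Sig \<odot> Sb \<odot> F) H"
proof (rule hom_iso_precomp[OF _ H])
  interpret F: is_functor A Q F by fact
  interpret G: nat_trans Q Q "Sig \<odot> Sb" "prod_left Q SQ L" \<gamma> by (rule \<gamma>_natural)
  interpret SF: is_functor A Q "Sig \<odot> Sb \<odot> F"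
    unfolding comp_func_assoc[symmetric] by (rule is_functor_comp[OF F]) unfold_locales
  interpret LF: is_functor A Q "prod_left Q SQ L \<odot> F" by (rule is_functor_comp[OF F]) unfold_locales
  show "nat_trans A Q (Sig \<odot> Sb \<odot> F) (prod_left Q SQ L \<odot> F) (\<lambda>a. \<gamma> (ob F a))"
    using G.component G.naturality[OF F.ar_hom] by unfold_locales auto
  show "bij_betw (\<lambda>h. h \<cdot>\<^bsub>Q\<^esub> \<gamma> (ob F a)) (hom Q (ob (prod_left Q SQ L \<odot> F) a) (ob H e))
      (hom Q (ob (Sig \<odot> Sb \<odot> F) a) (ob H e))" if ae: "a \<in> Ob A" "e \<in> Ob E" for a e
  proof -
    obtain N w where "N \<in> Ob Q" "mixed N" "w \<in> iso Q (ob F a) N"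
      using mixed[OF ae(1)] by blast
    moreover obtain Z z where "Z \<in> Ob M" "z \<in> iso Q (ob I Z) (ob H e)"
      using reflective[OF ae(2)] by blast
    ultimately have "precomp_bij Q (ob Sig (ob Sb (ob F a))) (Prod SQ L (ob F a)) (ob H e) (\<gamma> (ob F a))"
      by (intro precomp_bij_\<gamma>)
    then show ?thesis
      by (simp add: precomp_bij_def prod_left_def)
  qed
qed

text \<open>In the application \<open>M1\<close> and \<open>I1\<close> are the fibre over the
  terminal object and its inclusion, on the same side as \<open>M\<close> and \<open>I\<close>, and
  \<open>c\<close> is \<open>const_b\<close>. One statement thus serves \<open>nat_from\<close> and
  \<open>nat_from'\<close>.\<close>

lemma nat_slice:
  assumes q: "quasi_inverse B M1 j J" and xM: "is_functor M M1 xM"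
    and I1: "is_functor M1 P I1" and ff: "fully_faithful M1 P I1"
    and square: "naturally_isomorphic M P (I1 \<odot> xM) (Sb \<odot> I)"
    and c: "naturally_isomorphic B P (I1 \<odot> j) (Sb \<odot> c)"
    and en: "adjoint B Q c en"
    and mixed: "\<And>b. b \<in> Ob B \<Longrightarrow> \<exists>N \<in> Ob Q. mixed N \<and> (\<exists>w. w \<in> iso Q (ob c b) N)"
  shows "naturally_isomorphic M B (J \<odot> xM) (en \<odot> exp_func Q SQ L \<odot> I)"
proof (rule yoneda_right)
  have j: "is_functor B M1 j" and J: "is_functor M1 B J"
    using q by (auto simp: quasi_inverse_def)
  obtain \<alpha> \<beta> where en': "adjunction B Q c en \<alpha> \<beta>"
    using en by (auto simp: adjoint_def)
  have cf: "is_functor B Q c"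
    by (rule adjunction.left_functor[OF en'])
  have B: "is_functor B B id_func"
    using is_functor_id is_functor.axioms(1)[OF j] by blast
  have Sc: "is_functor B P (Sb \<odot> c)"
    by (rule is_functor_comp[OF cf]) unfold_locales
  have I: "is_functor M Q I" ..
  have ex: "is_functor M Q (exp_func Q SQ L \<odot> I)"
    by (rule is_functor_comp[OF I Q.is_functor_exp_func[OF L_Ob]])
  \<comment> \<open>The first two links remove \<open>J\<close>: \<open>j\<close> is fully faithful,
    and \<open>j \<odot> J\<close> is isomorphic to the identity.\<close>
  have "hom_iso B M B id_func (J \<odot> xM) M1 j (j \<odot> J \<odot> xM)"
    using hom_iso_fully_faithful[OF quasi_inverse_fully_faithful[OF q] j B is_functor_comp[OF xM J]]
    by simp
  also have "hom_iso B M M1 j (j \<odot> J \<odot> xM) M1 j xM"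
    using naturally_isomorphic_comp_right[OF _ xM, of M1 "j \<odot> J" id_func] q
    by (intro hom_iso_right[OF _ j]) (auto simp: quasi_inverse_def comp_func_assoc)
  also have "hom_iso B M M1 j xM P (I1 \<odot> j) (I1 \<odot> xM)"
    by (rule hom_iso_fully_faithful[OF ff I1 j xM])
  also have "hom_iso B M P (I1 \<odot> j) (I1 \<odot> xM) P (Sb \<odot> c) (I1 \<odot> xM)"
    by (rule hom_iso_left[OF c is_functor_comp[OF xM I1]])
  also have "hom_iso B M P (Sb \<odot> c) (I1 \<odot> xM) P (Sb \<odot> c) (Sb \<odot> I)"
    by (rule hom_iso_right[OF square Sc])
  also have "hom_iso B M P (Sb \<odot> c) (Sb \<odot> I) Q (Sig \<odot> Sb \<odot> c) I"
    by (rule hom_iso_sym[OF hom_iso_adjunction[OF Sig.adjunction_axioms Sc I]])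
  \<comment> \<open>The link that rests on the Frobenius laws: values of \<open>c\<close> are
    isomorphic to objects satisfying \<open>mixed\<close>, and the target objects lie in the image
    of \<open>I\<close> on the nose.\<close>
  also have "hom_iso B M Q (Sig \<odot> Sb \<odot> c) I Q (prod_left Q SQ L \<odot> c) I"
    by (rule hom_iso_sym[OF hom_iso_\<gamma>[OF cf I mixed]]) (use Q.iso_Idt I_fun.ob_Ob in blast)+
  also have "hom_iso B M Q (prod_left Q SQ L \<odot> c) I Q (prod_right Q SQ L \<odot> c) I"
    by (rule hom_iso_left[OF naturally_isomorphic_comp_right[OF Q.prod_left_iso_right[OF L_Ob] cf] I])
  also have "hom_iso B M Q (prod_right Q SQ L \<odot> c) I Q c (exp_func Q SQ L \<odot> I)"
    by (rule Q.hom_iso_exp[OF L_Ob cf I])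
  also have "hom_iso B M Q c (exp_func Q SQ L \<odot> I) B id_func (en \<odot> exp_func Q SQ L \<odot> I)"
    using hom_iso_adjunction[OF en' B ex] by simp
  finally show "hom_iso B M B id_func (J \<odot> xM) B id_func (en \<odot> exp_func Q SQ L \<odot> I)" .
qed

text \<open>The dual chain, for hom sets out of \<open>J \<odot> xM\<close>. In the application
  \<open>M1\<close>, \<open>M2\<close>, \<open>I1\<close> and \<open>I2\<close> are on the side
  opposite to \<open>M\<close> and \<open>I\<close>, and it is now \<open>c\<close> that has to take
  values in the image of \<open>I\<close> up to isomorphism. Allowing \<open>pr\<close> to be any
  functor isomorphic to \<open>prod_left\<close> covers both \<open>ten_left\<close> and
  \<open>ten_right\<close>.\<close>

lemma ten_slice:
  assumes q: "quasi_inverse B M1 j J" and xM: "is_functor M2 M1 xM"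
    and I1: "is_functor M1 P I1" and ff: "fully_faithful M1 P I1" and I2: "is_functor M2 Q I2"
    and square: "naturally_isomorphic M2 P (I1 \<odot> xM) (Sb \<odot> I2)"
    and c: "naturally_isomorphic B P (I1 \<odot> j) (Sb \<odot> c)"
    and co: "adjoint Q B co c"
    and mixed: "\<And>m. m \<in> Ob M2 \<Longrightarrow> mixed (ob I2 m)"
    and reflective: "\<And>b. b \<in> Ob B \<Longrightarrow> \<exists>Z \<in> Ob M. \<exists>z. z \<in> iso Q (ob I Z) (ob c b)"
    and pr: "naturally_isomorphic Q Q (prod_left Q SQ L) pr" "is_functor Q Q pr"
  shows "naturally_isomorphic M2 B (J \<odot> xM) (co \<odot> pr \<odot> I2)"
proof (rule yoneda_left)
  have j: "is_functor B M1 j" and J: "is_functor M1 B J"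
    using q by (auto simp: quasi_inverse_def)
  obtain \<alpha> \<beta> where co': "adjunction Q B co c \<alpha> \<beta>"
    using co by (auto simp: adjoint_def)
  have cf: "is_functor B Q c"
    by (rule adjunction.right_functor[OF co'])
  have B: "is_functor B B id_func"
    using is_functor_id is_functor.axioms(1)[OF j] by blast
  have SI: "is_functor M2 P (Sb \<odot> I2)"
    by (rule is_functor_comp[OF I2]) unfold_locales
  interpret I2: is_functor M2 Q I2 by fact
  have "hom_iso M2 B B (J \<odot> xM) id_func M1 (j \<odot> J \<odot> xM) j"
    using hom_iso_fully_faithful[OF quasi_inverse_fully_faithful[OF q] j is_functor_comp[OF xM J] B]
    by simp
  also have "hom_iso M2 B M1 (j \<odot> J \<odot> xM) j M1 xM j"
    using naturally_isomorphic_comp_right[OF _ xM, of M1 "j \<odot> J" id_func] q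
    by (intro hom_iso_left[OF _ j]) (auto simp: quasi_inverse_def comp_func_assoc)
  also have "hom_iso M2 B M1 xM j P (I1 \<odot> xM) (I1 \<odot> j)"
    by (rule hom_iso_fully_faithful[OF ff I1 xM j])
  also have "hom_iso M2 B P (I1 \<odot> xM) (I1 \<odot> j) P (Sb \<odot> I2) (I1 \<odot> j)"
    by (rule hom_iso_left[OF square is_functor_comp[OF j I1]])
  also have "hom_iso M2 B P (Sb \<odot> I2) (I1 \<odot> j) P (Sb \<odot> I2) (Sb \<odot> c)"
    by (rule hom_iso_right[OF c SI])
  also have "hom_iso M2 B P (Sb \<odot> I2) (Sb \<odot> c) Q (Sig \<odot> Sb \<odot> I2) c"
    by (rule hom_iso_sym[OF hom_iso_adjunction[OF Sig.adjunction_axioms SI cf]])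
  also have "hom_iso M2 B Q (Sig \<odot> Sb \<odot> I2) c Q (prod_left Q SQ L \<odot> I2) c"
    by (rule hom_iso_sym[OF hom_iso_\<gamma>[OF I2 cf _ reflective]]) (use Q.iso_Idt I2.ob_Ob mixed in blast)+
  also have "hom_iso M2 B Q (prod_left Q SQ L \<odot> I2) c Q (pr \<odot> I2) c"
    by (rule hom_iso_left[OF naturally_isomorphic_comp_right[OF pr(1) I2] cf])
  also have "hom_iso M2 B Q (pr \<odot> I2) c B (co \<odot> pr \<odot> I2) id_func"
    using hom_iso_sym[OF hom_iso_adjunction[OF co' is_functor_comp[OF I2 pr(2)] B]] by simp
  finally show "hom_iso M2 B B (J \<odot> xM) id_func B (co \<odot> pr \<odot> I2) id_func" .
qed

end

section \<open>Temporal doctrines\<close>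

text \<open>The components are the isomorphisms stored in the objects, and the compatibility
  required of arrows is their naturality.\<close>

lemma pullback_fst_iso_snd:
  assumes F: "is_functor A K F" and F': "is_functor A' K F'"
    and "is_functor (pullback_cat A A' K F F') A pb_fst" "is_functor (pullback_cat A A' K F F') A' pb_snd"
  shows "naturally_isomorphic (pullback_cat A A' K F F') K (F \<odot> pb_fst) (F' \<odot> pb_snd)"
proof -
  interpret L: is_functor "pullback_cat A A' K F F'" K "F \<odot> pb_fst"
    by (rule is_functor_comp) fact+
  interpret R: is_functor "pullback_cat A A' K F F'" K "F' \<odot> pb_snd"
    by (rule is_functor_comp) fact+
  have "nat_iso (pullback_cat A A' K F F') K (F \<odot> pb_fst) (F' \<odot> pb_snd) (\<lambda>(M, N, \<phi>). \<phi>)"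
    by unfold_locales
      (auto simp: pullback_cat_def Let_def pb_fst_def pb_snd_def iso_hom hom_def[of "cat_ext _ _ _ _ _ _ _"])
  then show ?thesis
    by (auto simp: naturally_isomorphic_def)
qed

context indexed_category
begin

text \<open>Compositor and unitor identify substitution along \<open>y\<close> and then
  \<open>x\<close> with substitution along an identity, hence with the identity functor. For a point
  \<open>x\<close> and the map from \<open>X\<close> to the terminal object, this says that
  restricting a constant to a point gives it back.\<close>

lemma Sub_section:
  assumes x: "x \<in> hom C T X" and y: "y \<in> hom C X T" and yx: "y \<cdot>\<^bsub>C\<^esub> x = Idt C T"
    and F: "is_functor B (Fib E T) F"
  shows "naturally_isomorphic B (Fib E T) F (Sub E x \<odot> Sub E y \<odot> F)"
proof -
  have T: "T \<in> Ob C"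
    using hom_Ob[OF x] by simp
  have "naturally_isomorphic (Fib E T) (Fib E T) id_func (Sub E (Idt C T))"
    using unitor_iso[OF T] by (auto simp: naturally_isomorphic_def)
  moreover have "naturally_isomorphic (Fib E T) (Fib E T) (Sub E x \<odot> Sub E y) (Sub E (Idt C T))"
    using compositor_iso[OF x y] by (auto simp: naturally_isomorphic_def yx)
  ultimately have "naturally_isomorphic (Fib E T) (Fib E T) id_func (Sub E x \<odot> Sub E y)"
    using naturally_isomorphic_trans naturally_isomorphic_sym by blast
  from naturally_isomorphic_comp_right[OF this F] show ?thesis
    by (simp add: comp_func_assoc)
qed

end

context indexed_functor
begin

lemma square_naturally_isomorphic:
  "f \<in> hom C X Y \<Longrightarrow>
    naturally_isomorphic (Fib E Y) (Fib E' X) (at I X \<odot> Sub E f) (Sub E' f \<odot> at I Y)"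
  using square_iso by (auto simp: naturally_isomorphic_def)

lemma square_component:
  "\<lbrakk>f \<in> hom C X Y; N \<in> Ob (Fib E Y)\<rbrakk> \<Longrightarrow>
    \<exists>w. w \<in> iso (Fib E' X) (ob (at I X) (ob (Sub E f) N)) (ob (Sub E' f) (ob (at I Y) N))"
  using nat_iso.component_iso[OF square_iso] by fastforce

end

lemma iso_sym: "\<exists>w. w \<in> iso C A B \<Longrightarrow> \<exists>w. w \<in> iso C B A"
  by (metis iso_inverseE)

context temporal_doctrine
begin

abbreviation toPt where
  "toPt \<equiv> to_terminal (Base D) (pt D)"

lemma frobenius_pairing:
  assumes f: "f \<in> hom (Base D) X Y" and "P \<in> Ob (Fib (Pc D) X)" "R \<in> Ob (Fib (Pc D) Y)"
  shows "pairing (Fib (Pc D) Y) (CC D Y) (ar (Sig D f) (Proj1 (CC D X) P (ob (Sub (Pc D) f) R)))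
      (Sig_counit D f R \<cdot>\<^bsub>Fib (Pc D) Y\<^esub> ar (Sig D f) (Proj2 (CC D X) P (ob (Sub (Pc D) f) R)))
    \<in> iso (Fib (Pc D) Y) (ob (Sig D f) (Prod (CC D X) P (ob (Sub (Pc D) f) R)))
        (Prod (CC D Y) (ob (Sig D f) P) R)"
proof -
  have "Dom (Base D) f = X" "Cod (Base D) f = Y"
    using f by (auto simp: hom_def)
  then show ?thesis
    using frobenius[OF assms] by (simp add: frobenius_map_def Let_def)
qed

text \<open>Taking the inclusion of \<open>t\<close> as \<open>T\<close>, rather than the chosen
  \<open>One\<close>, makes \<open>ob Dia (ob Sig T)\<close> literally the slice at
  \<open>x\<close>.\<close>

lemma frobenius_reflection_left:
  assumes x: "x \<in> hom (Base D) (pt D) X" and t: "terminal (Fib (Mc D) (pt D)) t"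
  shows "frobenius_reflection (Fib (Pc D) (pt D)) (CC D (pt D)) (Fib (Pc D) X) (CC D X)
    (Sig D x) (Sub (Pc D) x) (Sig_unit D x) (Sig_counit D x)
    (Fib (Mc D) X) (Dia D X) (at (im D) X) (Dia_unit D X) (Dia_counit D X)
    (ob (at (im D) (pt D)) t)"
proof -
  have o: "pt D \<in> Ob (Base D)" "X \<in> Ob (Base D)"
    using i.E.hom_Ob[OF x] by auto
  have T: "terminal (Fib (Pc D) (pt D)) (ob (at (im D) (pt D)) t)"
    by (rule right_adjoint_terminal[OF Dia_adjunction[OF o(1)] t])
  then have "ob (at (im D) (pt D)) t \<in> Ob (Fib (Pc D) (pt D))"
    by (simp add: terminal_def)
  then show ?thesis
    by (intro frobenius_reflection.intro frobenius_reflection_axioms.intro T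
        P_cartesian_closed Sig_adjunction[OF x] Dia_adjunction o frobenius_pairing[OF x])
qed

lemma frobenius_reflection_right:
  assumes x: "x \<in> hom (Base D) (pt D) X" and t': "terminal (Fib (Mc' D) (pt D)) t'"
  shows "frobenius_reflection (Fib (Pc D) (pt D)) (CC D (pt D)) (Fib (Pc D) X) (CC D X)
    (Sig D x) (Sub (Pc D) x) (Sig_unit D x) (Sig_counit D x)
    (Fib (Mc' D) X) (Dia' D X) (at (im' D) X) (Dia_unit' D X) (Dia_counit' D X)
    (ob (at (im' D) (pt D)) t')"
proof -
  have o: "pt D \<in> Ob (Base D)" "X \<in> Ob (Base D)"
    using i.E.hom_Ob[OF x] by auto
  have T: "terminal (Fib (Pc D) (pt D)) (ob (at (im' D) (pt D)) t')"
    by (rule right_adjoint_terminal[OF Dia_adjunction'[OF o(1)] t'])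
  then have "ob (at (im' D) (pt D)) t' \<in> Ob (Fib (Pc D) (pt D))"
    by (simp add: terminal_def)
  then show ?thesis
    by (intro frobenius_reflection.intro frobenius_reflection_axioms.intro T
        P_cartesian_closed Sig_adjunction[OF x] Dia_adjunction' o frobenius_pairing[OF x])
qed

end

section \<open>The four isomorphisms for a point of a temporal doctrine\<close>

theorem corollary7p2:
  fixes D :: "('c, 'f, 'm, 'ma, 'p, 'pa, 'n, 'na) tdoctrine"
  assumes "temporal_doctrine D"
    and point: "x \<in> hom (Base D) (pt D) X"
    and tops: "terminal (Fib (Mc D) (pt D)) t" "terminal (Fib (Mc' D) (pt D)) t'"
    and j_inv: "quasi_inverse (BB D (pt D)) (Fib (Mc D) (pt D)) pb_fst J"
    and j_inv': "quasi_inverse (BB D (pt D)) (Fib (Mc' D) (pt D)) pb_snd J'"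
    and coend: "is_coend D X co"
    and "end": "is_end D X en"
  shows "naturally_isomorphic (Fib (Mc D) X) (BB D (pt D)) (J \<odot> Sub (Mc D) x) (nat_from D X en (left_slice D t x)) \<and>
    naturally_isomorphic (Fib (Mc D) X) (BB D (pt D)) (J \<odot> Sub (Mc D) x) (ten_left D X co (right_slice D t' x)) \<and>
    naturally_isomorphic (Fib (Mc' D) X) (BB D (pt D)) (J' \<odot> Sub (Mc' D) x) (nat_from' D X en (right_slice D t' x)) \<and>
    naturally_isomorphic (Fib (Mc' D) X) (BB D (pt D)) (J' \<odot> Sub (Mc' D) x) (ten_right D X co (left_slice D t x))"
proof -
  interpret temporal_doctrine D by fact
  interpret l: frobenius_reflection "Fib (Pc D) (pt D)" "CC D (pt D)" "Fib (Pc D) X" "CC D X"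
    "Sig D x" "Sub (Pc D) x" "Sig_unit D x" "Sig_counit D x"
    "Fib (Mc D) X" "Dia D X" "at (im D) X" "Dia_unit D X" "Dia_counit D X"
    "ob (at (im D) (pt D)) t"
    by (rule frobenius_reflection_left[OF point tops(1)])
  interpret r: frobenius_reflection "Fib (Pc D) (pt D)" "CC D (pt D)" "Fib (Pc D) X" "CC D X"
    "Sig D x" "Sub (Pc D) x" "Sig_unit D x" "Sig_counit D x"
    "Fib (Mc' D) X" "Dia' D X" "at (im' D) X" "Dia_unit' D X" "Dia_counit' D X"
    "ob (at (im' D) (pt D)) t'"
    by (rule frobenius_reflection_right[OF point tops(2)])
  have pt: "pt D \<in> Ob (Base D)" and X: "X \<in> Ob (Base D)"
    using i.E.hom_Ob[OF point] by auto
  have dom: "Dom (Base D) x = pt D" "Cod (Base D) x = X"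
    using point by (auto simp: hom_def)
  have L: "l.L = ob (at (im D) X) (left_slice D t x)" "r.L = ob (at (im' D) X) (right_slice D t' x)"
    unfolding l.L_def r.L_def by (simp_all add: left_slice_def right_slice_def ex_def ex'_def dom)
  have y: "toPt X \<in> hom (Base D) X (pt D)"
    by (rule i.E.to_terminal_hom[OF pt_terminal X])
  have yx: "toPt X \<cdot>\<^bsub>Base D\<^esub> x = Idt (Base D) (pt D)"
    using i.E.terminal_eq[OF pt_terminal i.E.Cmp_hom[OF point y] i.E.Idt_hom[OF pt]] .
  have j: "is_functor (BB D (pt D)) (Fib (Mc D) (pt D)) pb_fst"
    and j': "is_functor (BB D (pt D)) (Fib (Mc' D) (pt D)) pb_snd"
    using j_inv j_inv' by (auto simp: quasi_inverse_def)
  have b: "is_functor (BB D (pt D)) (Fib (Pc D) (pt D)) (bb D (pt D))"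
    unfolding bb_def by (rule is_functor_comp[OF j i.at_functor[OF pt]])
  have c: "naturally_isomorphic (BB D (pt D)) (Fib (Pc D) (pt D)) (at (im D) (pt D) \<odot> pb_fst) (Sub (Pc D) x \<odot> const_b D X)"
    using i.E'.Sub_section[OF point y yx b] by (simp add: const_b_def bb_def)
  \<comment> \<open>\<open>const_b\<close> is written with \<open>i\<close> and the first
    projection; the isomorphisms stored in the pullback give the version with \<open>i'\<close> and
    the second projection, which the primed statements use.\<close>
  have "naturally_isomorphic (BB D (pt D)) (Fib (Pc D) (pt D)) (at (im D) (pt D) \<odot> pb_fst) (at (im' D) (pt D) \<odot> pb_snd)"
    using pullback_fst_iso_snd[OF i.at_functor[OF pt] i'.at_functor[OF pt]] j j' by (simp add: BB_def)
  from naturally_isomorphic_trans[OF naturally_isomorphic_sym[OF this] c]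
  have c': "naturally_isomorphic (BB D (pt D)) (Fib (Pc D) (pt D)) (at (im' D) (pt D) \<odot> pb_snd) (Sub (Pc D) x \<odot> const_b D X)" .
  interpret y: is_functor "Fib (Pc D) (pt D)" "Fib (Pc D) X" "Sub (Pc D) (toPt X)"
    by (rule i.E'.Sub_functor[OF y])
  \<comment> \<open>The witness is the substitution of the first component along
    \<open>X \<rightarrow> 1\<close>, compared by the coherence square of \<open>i\<close>.\<close>
  have in_left: "\<exists>Z \<in> Ob (Fib (Mc D) X). \<exists>z. z \<in> iso (Fib (Pc D) X) (ob (at (im D) X) Z) (ob (const_b D X) B)"
    if B: "B \<in> Ob (BB D (pt D))" for B
    using i.square_component[OF y is_functor.ob_Ob[OF j B]] is_functor.ob_Ob[OF i.E.Sub_functor[OF y] is_functor.ob_Ob[OF j B]]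
    by (auto simp: const_b_def bb_def)
  \<comment> \<open>For \<open>i'\<close> the stored isomorphism \<open>\<phi>\<close> must first
    replace the first component by the second; only then does the coherence square of
    \<open>i'\<close> apply.\<close>
  have in_right: "\<exists>Z \<in> Ob (Fib (Mc' D) X). \<exists>z. z \<in> iso (Fib (Pc D) X) (ob (at (im' D) X) Z) (ob (const_b D X) B)"
    if B: "B \<in> Ob (BB D (pt D))" for B
  proof -
    obtain M N \<phi> where [simp]: "B = (M, N, \<phi>)"
      by (cases B)
    have N: "N \<in> Ob (Fib (Mc' D) (pt D))"
      and "\<phi> \<in> iso (Fib (Pc D) (pt D)) (ob (at (im D) (pt D)) M) (ob (at (im' D) (pt D)) N)"
      using B by (auto simp: BB_def pullback_cat_def)
    from y.ar_iso[OF this(2)]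
    obtain v where "v \<in> iso (Fib (Pc D) X) (ob (Sub (Pc D) (toPt X)) (ob (at (im' D) (pt D)) N)) (ob (const_b D X) B)"
      using iso_inverseE by (force simp: const_b_def bb_def pb_fst_def)
    with i'.square_component[OF y N] show ?thesis
      using is_functor.ob_Ob[OF i'.E.Sub_functor[OF y] N] l.Q.iso_Cmp by blast
  qed
  \<comment> \<open>The mixed Frobenius laws are used at the object \<open>ob Sig T\<close> only, on
    the side opposite to the reflection.\<close>
  have mixed: "l.mixed (ob (at (im' D) X) N)" if "N \<in> Ob (Fib (Mc' D) X)" for N
    unfolding l.mixed_def l.L_def using mixed_frobenius[OF X _ that] l.T_Ob by simp
  have mixed': "r.mixed (ob (at (im D) X) M)" if "M \<in> Ob (Fib (Mc D) X)" for M
    unfolding r.mixed_def r.L_def using mixed_frobenius'[OF X _ that] r.T_Ob by simp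
  note F = i.E.Sub_functor[OF point] i.at_functor[OF pt] i_fully_faithful[OF pt]
    and F' = i'.E.Sub_functor[OF point] i'.at_functor[OF pt] i_fully_faithful'[OF pt]
    and sq = i.square_naturally_isomorphic[OF point] and sq' = i'.square_naturally_isomorphic[OF point]
  \<comment> \<open>Constants lie in both images up to isomorphism, so they satisfy the mixed
    condition for either reflection.\<close>
  have mixed_b: "\<exists>N \<in> Ob (Fib (Pc D) X). l.mixed N \<and> (\<exists>w. w \<in> iso (Fib (Pc D) X) (ob (const_b D X) B) N)"
    if "B \<in> Ob (BB D (pt D))" for B
    using in_right[OF that] mixed r.I_fun.ob_Ob iso_sym by metis
  have mixed_b': "\<exists>N \<in> Ob (Fib (Pc D) X). r.mixed N \<and> (\<exists>w. w \<in> iso (Fib (Pc D) X) (ob (const_b D X) B) N)"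
    if "B \<in> Ob (BB D (pt D))" for B
    using in_left[OF that] mixed' l.I_fun.ob_Ob iso_sym by metis
  note en = "end"[unfolded is_end_def] and co = coend[unfolded is_coend_def]
  note pl = l.Q.is_functor_prod_left and pr = l.Q.is_functor_prod_right
  \<comment> \<open>The slice decides the reflection: \<open>left_slice\<close> comes from
    \<open>Dia\<close> and calls for \<open>l\<close>, \<open>right_slice\<close> comes from
    \<open>Dia'\<close> and calls for \<open>r\<close>, whichever side the variable object is
    on.\<close>
  show ?thesis
  proof (intro conjI)
    show "naturally_isomorphic (Fib (Mc D) X) (BB D (pt D)) (J \<odot> Sub (Mc D) x) (nat_from D X en (left_slice D t x))"
      unfolding nat_from_def L[symmetric] by (rule l.nat_slice[OF j_inv F sq c en mixed_b])
    show "naturally_isomorphic (Fib (Mc D) X) (BB D (pt D)) (J \<odot> Sub (Mc D) x) (ten_left D X co (right_slice D t' x))"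
      unfolding ten_left_def L[symmetric]
      by (rule r.ten_slice[OF j_inv F i.at_functor[OF X] sq c co mixed' in_right
            naturally_isomorphic_refl[OF pl[OF r.L_Ob]] pl[OF r.L_Ob]])
    show "naturally_isomorphic (Fib (Mc' D) X) (BB D (pt D)) (J' \<odot> Sub (Mc' D) x) (nat_from' D X en (right_slice D t' x))"
      unfolding nat_from'_def L[symmetric] by (rule r.nat_slice[OF j_inv' F' sq' c' en mixed_b'])
    show "naturally_isomorphic (Fib (Mc' D) X) (BB D (pt D)) (J' \<odot> Sub (Mc' D) x) (ten_right D X co (left_slice D t x))"
      unfolding ten_right_def L[symmetric]
      by (rule l.ten_slice[OF j_inv' F' i'.at_functor[OF X] sq' c' co mixed in_left
            l.Q.prod_left_iso_right[OF l.L_Ob] pr[OF l.L_Ob]])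
  qed
qed

end
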